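(* For $i=1,2$ let $\tilde{\boldsymbol\mu}^{(i)}\sim\mathrm{hCRV}(\rho^{(i)},\rho_0^{(i)},P_0^{(i)})$, where $\rho^{(i)},\rho_0^{(i)}$ are Lévy measures on $(0,+\infty)$ and $P_0^{(i)}$ are atomless probability measures on $\mathbb X$. Then $\tilde{\boldsymbol\mu}^{(1)}$ and $\tilde{\boldsymbol\mu}^{(2)}$ are equal in distribution if and only if there exists $c>0$ such that $$\rho_0^{(2)}=(c^{-1})_{\#}\rho_0^{(1)},\qquad \rho^{(2)}=c\,\rho^{(1)},\qquad P_0^{(1)}=P_0^{(2)},$$ where for $a>0$, $a_{\#}$ denotes pushforward under the map $s\mapsto as$. In particular, if all $\rho^{(i)},\rho_0^{(i)}$ have Lévy densities, this is equivalent to the existence of $c>0$ with $\rho_0^{(2)}(s)=c\,\rho_0^{(1)}(cs)$, $\rho^{(2)}(s)=c\,\rho^{(1)}(s)$ for all $s>0$, and $P_0^{(1)}=P_0^{(2)}$.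
   Context: Let $\mathbb X$ be a Polish space. A Lévy measure on $(0,+\infty)$ is a σ-finite measure $\rho$ with $\rho((\epsilon,+\infty))<\infty$ and $\int_{(0,\epsilon)}s\,\mathrm d\rho(s)<\infty$ for all $\epsilon>0$; its Laplace exponent is $\psi(\lambda)=\int_0^{+\infty}(1-e^{-\lambda s})\,\mathrm d\rho(s)$. For a finite (possibly random) measure $m$ on $\mathbb X$, $\tilde\mu\sim\mathrm{CRM}(\rho\otimes m)$ means that (conditionally on $m$) evaluations of $\tilde\mu$ on pairwise disjoint Borel sets are independent and $E[e^{-\lambda\tilde\mu(A)}]=e^{-m(A)\psi(\lambda)}$. $\tilde{\boldsymbol\mu}=(\tilde\mu_1,\dots,\tilde\mu_d)\sim\mathrm{hCRV}(\rho,\rho_0,P_0)$ means $\tilde\mu_0\sim\mathrm{CRM}(\rho_0\otimes P_0)$ and, conditionally on $\tilde\mu_0$, $\tilde\mu_1,\dots,\tilde\mu_d$ are independent with $\tilde\mu_i\sim\mathrm{CRM}(\rho\otimes\tilde\mu_0)$. Equality in distribution is as random elements of the space of $d$-tuples of boundedly finite measures on $\mathbb X$.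
   Formalization: Assumes d ≥ 2 and that all four Lévy measures are nonzero (the "only if" fails for d = 1, e.g. swapped stable measures, or when a Lévy measure vanishes), and the density identities are stated for Lebesgue-almost every s > 0, since densities are only determined almost everywhere. *)

theory Defs
  imports "HOL-Probability.Probability"
begin

text \<open>Levy measure on (0,+infinity), represented as a Borel measure on the reals
  giving no mass to (-infinity,0].\<close>
definition levy_measure :: "real measure \<Rightarrow> bool" where
  "levy_measure \<rho> \<longleftrightarrow> sets \<rho> = sets borel \<and> emeasure \<rho> {..0} = 0 \<and>
     sigma_finite_measure \<rho> \<and>
     (\<forall>\<epsilon>>0. emeasure \<rho> {\<epsilon><..} < \<infinity> \<and>
              (\<integral>\<^sup>+ s. ennreal s * indicator {0<..<\<epsilon>} s \<partial>\<rho>) < \<infinity>)"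

definition laplace_exp :: "real measure \<Rightarrow> real \<Rightarrow> real" where
  "laplace_exp \<rho> t = (\<integral>s. 1 - exp (- t * s) \<partial>\<rho>)"

text \<open>exp(-lambda x) for x in [0,infinity], with 0 * infinity = 0.\<close>
definition expneg :: "real \<Rightarrow> ennreal \<Rightarrow> real" where
  "expneg t x = (if x = \<infinity> then (if t = 0 then 1 else 0) else exp (- t * enn2real x))"

definition bfm :: "('x::polish_space) measure set" where
  "bfm = {m. sets m = sets borel \<and> (\<forall>A\<in>sets borel. bounded A \<longrightarrow> emeasure m A < \<infinity>)}"

definition rm1 :: "('x::polish_space) measure measure" where
  "rm1 = sigma bfm {{m \<in> bfm. emeasure m A \<in> B} | A B. A \<in> sets borel \<and> B \<in> sets (borel :: ennreal measure)}"

definition rm_space :: "nat \<Rightarrow> (nat \<Rightarrow> ('x::polish_space) measure) measure" where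
  "rm_space d = sigma {m. \<forall>i\<in>{1..d}. m i \<in> bfm}
     {{m. \<forall>i\<in>{1..d}. m i \<in> bfm} \<inter> {m. emeasure (m i) A \<in> B} | i A B.
        i \<in> {1..d} \<and> A \<in> sets borel \<and> B \<in> sets (borel :: ennreal measure)}"

definition is_CRM :: "'a measure \<Rightarrow> ('a \<Rightarrow> ('x::polish_space) measure) \<Rightarrow> real measure \<Rightarrow> 'x measure \<Rightarrow> bool" where
  "is_CRM M \<mu> \<rho> P \<longleftrightarrow> \<mu> \<in> measurable M rm1 \<and>
     (\<forall>A::nat \<Rightarrow> 'x set. disjoint_family A \<and> range A \<subseteq> sets borel \<longrightarrow>
        prob_space.indep_vars M (\<lambda>_. borel) (\<lambda>j \<omega>. emeasure (\<mu> \<omega>) (A j)) UNIV) \<and>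
     (\<forall>A\<in>sets borel. \<forall>t\<ge>0.
        (\<integral>\<omega>. expneg t (emeasure (\<mu> \<omega>) A) \<partial>M) = exp (- measure P A * laplace_exp \<rho> t))"

text \<open>Conditionally on mu0, mu_1..mu_d are independent with mu_i ~ CRM(rho (x) mu0):
  expressed via the conditional joint Laplace transform of evaluations on
  pairwise disjoint Borel sets, tested against events of sigma(mu0).\<close>
definition cond_CRMs :: "'a measure \<Rightarrow> nat \<Rightarrow> ('a \<Rightarrow> nat \<Rightarrow> ('x::polish_space) measure) \<Rightarrow>
    ('a \<Rightarrow> 'x measure) \<Rightarrow> real measure \<Rightarrow> bool" where
  "cond_CRMs M d \<mu> \<mu>0 \<rho> \<longleftrightarrow>
     (\<forall>(k::nat) (A::nat \<Rightarrow> 'x set) (lam::nat \<Rightarrow> nat \<Rightarrow> real) E.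
        disjoint_family_on A {..<k} \<and> A ` {..<k} \<subseteq> sets borel \<and> (\<forall>i j. 0 \<le> lam i j) \<and>
        E \<in> sets rm1 \<longrightarrow>
        (\<integral>\<omega>. indicator E (\<mu>0 \<omega>) *
              (\<Prod>i\<in>{1..d}. \<Prod>j<k. expneg (lam i j) (emeasure (\<mu> \<omega> i) (A j))) \<partial>M)
      = (\<integral>\<omega>. indicator E (\<mu>0 \<omega>) *
              (\<Prod>i\<in>{1..d}. \<Prod>j<k. expneg (laplace_exp \<rho> (lam i j)) (emeasure (\<mu>0 \<omega>) (A j))) \<partial>M))"

definition is_hCRV :: "'a measure \<Rightarrow> nat \<Rightarrow> ('a \<Rightarrow> nat \<Rightarrow> ('x::polish_space) measure) \<Rightarrow>
    real measure \<Rightarrow> real measure \<Rightarrow> 'x measure \<Rightarrow> bool" where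
  "is_hCRV M d \<mu> \<rho> \<rho>0 P0 \<longleftrightarrow> prob_space M \<and> \<mu> \<in> measurable M (rm_space d) \<and>
     (\<exists>\<mu>0. is_CRM M \<mu>0 \<rho>0 P0 \<and> cond_CRMs M d \<mu> \<mu>0 \<rho>)"

definition eq_dist :: "nat \<Rightarrow> 'a measure \<Rightarrow> ('a \<Rightarrow> nat \<Rightarrow> ('x::polish_space) measure) \<Rightarrow>
    'b measure \<Rightarrow> ('b \<Rightarrow> nat \<Rightarrow> 'x measure) \<Rightarrow> bool" where
  "eq_dist d M1 \<mu>1 M2 \<mu>2 \<longleftrightarrow> distr M1 (rm_space d) \<mu>1 = distr M2 (rm_space d) \<mu>2"

definition atomless_prob :: "('x::polish_space) measure \<Rightarrow> bool" where
  "atomless_prob P \<longleftrightarrow> prob_space P \<and> sets P = sets borel \<and> (\<forall>x. emeasure P {x} = 0)"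

end

theory Submission
  imports Defs "HOL-Complex_Analysis.Conformal_Mappings"
begin

text \<open>
  Let \<open>\<psi>\<close> and \<open>\<psi>\<^sub>0\<close> be the Laplace exponents of \<open>\<rho>\<close> and \<open>\<rho>\<^sub>0\<close>. Evaluations on disjoint sets
  \<open>A\<^sub>j\<close> have joint Laplace transform \<open>\<Prod>\<^sub>j exp (- P\<^sub>0(A\<^sub>j) \<psi>\<^sub>0(\<Sum>\<^sub>i \<psi>(\<lambda>\<^sub>i\<^sub>j)))\<close>. These transforms
  determine the law: overlapping sets are unions of atoms, and the substitution \<open>x \<mapsto> exp (- x)\<close>
  turns Laplace transforms into moments of variables with values in \<open>[0, 1]\<close>. Hence equality in
  distribution means that \<open>P\<^sub>0(A) \<psi>\<^sub>0(\<Sum>\<^sub>i \<psi>(\<lambda>\<^sub>i))\<close> agrees for both models.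

  Since \<open>d \<ge> 2\<close>, two coordinates give \<open>\<psi>\<^sub>0(\<psi>(a) + \<psi>(b))\<close> for all \<open>a\<close>, \<open>b\<close>. Differentiating in
  \<open>a\<close> and in \<open>b\<close> and dividing eliminates \<open>\<psi>\<^sub>0'\<close>, so that the ratio of the derivatives of the two
  functions \<open>\<psi>\<close> is a constant \<open>c\<close>. Then the outer exponents are related by \<open>x \<mapsto> c x\<close>, but only on
  the range of \<open>\<psi>\<close>, which may be a bounded interval. This suffices: the Laplace exponent extends
  holomorphically to the right half plane, and its derivative on the line \<open>Re z = 1\<close> is the
  characteristic function of the finite measure \<open>s exp (- s) \<rho>(ds)\<close>.
\<close>

section \<open>Characteristic functions and moments of finite measures\<close>

lemma char_density_const:
  assumes [measurable_cong]: "sets M = sets borel" and "0 \<le> r"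
  shows "char (density M (\<lambda>_. ennreal r)) t = of_real r * char M t"
  unfolding char_def using assms(2)
  by (subst integral_density) (auto simp: scaleR_conv_of_real)

lemma finite_measure_eqI_char:
  fixes M N :: "real measure"
  assumes M: "finite_measure M" "sets M = sets borel"
    and N: "finite_measure N" "sets N = sets borel"
    and char: "char M = char N"
  shows "M = N"
proof -
  interpret M: finite_measure M by fact
  interpret N: finite_measure N by fact
  define m where "m = measure M (space M)"
  have "complex_of_real (measure N (space N)) = of_real m"
    using fun_cong[OF char, of 0] by (simp add: char_def m_def)
  then have mass: "emeasure M (space M) = ennreal m" "emeasure N (space N) = ennreal m"
    by (simp_all add: M.emeasure_eq_measure N.emeasure_eq_measure m_def)
  show ?thesis
  proof (cases "m = 0")
    case True
    then have "emeasure M A = 0" "emeasure N A = 0" for A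
      using mass emeasure_space[of M A] emeasure_space[of N A] by simp_all
    then show ?thesis using M(2) N(2) by (intro measure_eqI) auto
  next
    case False
    then have "0 < m" by (simp add: m_def less_le)
    define normalize where "normalize K = density K (\<lambda>_. ennreal (1 / m))" for K :: "real measure"
    have rescale: "density (normalize K) (\<lambda>_. ennreal m) = K" for K
      using \<open>0 < m\<close>
      by (simp add: normalize_def density_density_eq ennreal_mult[symmetric] density_1)
    have "real_distribution (normalize K)"
      if "sets K = sets borel" "emeasure K (space K) = ennreal m" for K
      using that \<open>0 < m\<close> sets_eq_imp_space_eq[OF that(1)]
      by (intro real_distribution.intro prob_spaceI real_distribution_axioms.intro)
         (auto simp: normalize_def emeasure_density_const ennreal_mult[symmetric])
    then have "normalize M = normalize N"
      using M N mass char \<open>0 < m\<close>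
      by (intro Levy_uniqueness) (simp_all add: fun_eq_iff normalize_def char_density_const)
    then show ?thesis using rescale by metis
  qed
qed

lemma char_sums_moments:
  fixes M :: "real measure"
  assumes M: "finite_measure M" "sets M = sets borel" and bounded: "AE x in M. \<bar>x\<bar> \<le> B"
  shows "(\<lambda>n. (\<i> * of_real t) ^ n / fact n * of_real (\<integral>x. x ^ n \<partial>M)) sums char M t"
proof -
  interpret finite_measure M by fact
  have [measurable_cong]: "sets M = sets borel" by fact
  define f where "f n x = (\<i> * of_real t) ^ n / fact n * of_real (x ^ n)" for n and x :: real
  define b where "b n = (\<bar>t\<bar> * B) ^ n / fact n" for n
  have [measurable]: "f n \<in> borel_measurable borel" for n unfolding f_def by measurable
  have f_le: "AE x in M. norm (f n x) \<le> b n" for n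
    using bounded
  proof eventually_elim
    case (elim x)
    then have "\<bar>x\<bar> ^ n \<le> B ^ n" by (intro power_mono) auto
    then show ?case
      by (auto simp: f_def b_def norm_mult norm_power norm_divide power_mult_distrib
          intro!: divide_right_mono mult_left_mono)
  qed
  have int_f: "integrable M (f n)" for n
    using f_le by (rule integrable_const_bound) measurable
  have summable_b: "summable b"
    using summable_exp[of "\<bar>t\<bar> * B"] by (simp add: b_def[abs_def] divide_inverse mult.commute)
  have iexp: "f n x = (\<i> * of_real (t * x)) ^ n /\<^sub>R fact n" for n x
    by (simp add: f_def power_mult_distrib scaleR_conv_of_real divide_inverse mult_ac)
  have "(\<lambda>n. \<integral>x. f n x \<partial>M) sums (\<integral>x. (\<Sum>n. f n x) \<partial>M)"
  proof (rule sums_integral[OF int_f])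
    have "summable (\<lambda>n. norm (f n x))" for x
      unfolding iexp by (rule summable_norm_exp)
    then show "AE x in M. summable (\<lambda>n. norm (f n x))" by simp
    have "(\<integral>x. norm (f n x) \<partial>M) \<le> b n * measure M (space M)" for n
      using integral_mono_AE[of M "\<lambda>x. norm (f n x)" "\<lambda>_. b n"] int_f f_le
      by (simp add: mult.commute)
    then show "summable (\<lambda>n. \<integral>x. norm (f n x) \<partial>M)"
      by (intro summable_comparison_test'[OF summable_mult2[OF summable_b]])
         (auto simp: integral_nonneg_AE)
  qed
  moreover have "(\<Sum>n. f n x) = iexp (t * x)" for x
    unfolding iexp exp_def ..
  ultimately show ?thesis by (simp add: f_def char_def del: of_real_power of_real_mult)
qed

lemma finite_measure_eqI_moments:
  fixes M N :: "real measure"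
  assumes M: "finite_measure M" "sets M = sets borel" "AE x in M. \<bar>x\<bar> \<le> B"
    and N: "finite_measure N" "sets N = sets borel" "AE x in N. \<bar>x\<bar> \<le> B"
    and moments: "\<And>n. (\<integral>x. x ^ n \<partial>M) = (\<integral>x. x ^ n \<partial>N)"
  shows "M = N"
proof (rule finite_measure_eqI_char)
  show "char M = char N"
    using char_sums_moments[OF M] char_sums_moments[OF N] unfolding moments
    by (intro ext) (rule sums_unique2)
qed fact+

section \<open>Joint moments of bounded random variables\<close>

definition weighted_law :: "'a measure \<Rightarrow> ('a \<Rightarrow> real) \<Rightarrow> ('a \<Rightarrow> real) \<Rightarrow> real measure" where
  "weighted_law M g X = distr (density M (\<lambda>\<omega>. ennreal (g \<omega>))) borel X"

lemma sets_weighted_law [simp]: "sets (weighted_law M g X) = sets borel"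
  by (simp add: weighted_law_def)

lemma finite_measure_weighted_law:
  assumes "X \<in> borel_measurable M" and g: "integrable M g" "AE \<omega> in M. 0 \<le> g \<omega>"
  shows "finite_measure (weighted_law M g X)"
proof -
  have "(\<integral>\<^sup>+\<omega>. ennreal (g \<omega>) \<partial>M) < \<infinity>"
    using nn_integral_eq_integral[OF g] by simp
  then have "finite_measure (density M (\<lambda>\<omega>. ennreal (g \<omega>)))"
    using g by (intro finite_measureI) (auto simp: emeasure_density cong: nn_integral_cong)
  then show ?thesis
    unfolding weighted_law_def using assms by (intro finite_measure.finite_measure_distr) auto
qed

lemma AE_weighted_law:
  assumes [measurable]: "X \<in> borel_measurable M" "g \<in> borel_measurable M" "Measurable.pred borel P"
    and "AE \<omega> in M. P (X \<omega>)"
  shows "AE x in weighted_law M g X. P x"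
  unfolding weighted_law_def using assms(4) by (subst AE_distr_iff) (auto simp: AE_density)

lemma integral_weighted_law:
  fixes h :: "real \<Rightarrow> real"
  assumes [measurable]: "X \<in> borel_measurable M" "g \<in> borel_measurable M"
      "h \<in> borel_measurable borel"
    and g: "AE \<omega> in M. 0 \<le> g \<omega>"
  shows "(\<integral>x. h x \<partial>weighted_law M g X) = (\<integral>\<omega>. h (X \<omega>) * g \<omega> \<partial>M)"
  unfolding weighted_law_def using g
  by (subst integral_distr) (auto simp: integral_density mult.commute)

lemma integral_comp_mult_eqI_moments:
  fixes X g :: "'a \<Rightarrow> real" and Y k :: "'b \<Rightarrow> real"
  assumes X: "X \<in> borel_measurable M" "AE \<omega> in M. \<bar>X \<omega>\<bar> \<le> B"
    and g: "integrable M g" "AE \<omega> in M. 0 \<le> g \<omega>"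
    and Y: "Y \<in> borel_measurable N" "AE \<omega> in N. \<bar>Y \<omega>\<bar> \<le> B"
    and k: "integrable N k" "AE \<omega> in N. 0 \<le> k \<omega>"
    and moments: "\<And>n. (\<integral>\<omega>. X \<omega> ^ n * g \<omega> \<partial>M) = (\<integral>\<omega>. Y \<omega> ^ n * k \<omega> \<partial>N)"
    and h: "h \<in> borel_measurable borel"
  shows "(\<integral>\<omega>. h (X \<omega>) * g \<omega> \<partial>M) = (\<integral>\<omega>. h (Y \<omega>) * k \<omega> \<partial>N)"
proof -
  have weights_measurable: "g \<in> borel_measurable M" "k \<in> borel_measurable N"
    using g(1) k(1) by auto
  have "weighted_law M g X = weighted_law N k Y"
  proof (rule finite_measure_eqI_moments[where B=B])
    show "(\<integral>x. x ^ n \<partial>weighted_law M g X) = (\<integral>x. x ^ n \<partial>weighted_law N k Y)" for n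
      using moments[of n] X(1) Y(1) g(2) k(2) weights_measurable
      by (simp add: integral_weighted_law)
  qed (use X Y g k weights_measurable in \<open>auto intro!: finite_measure_weighted_law AE_weighted_law\<close>)
  then have "(\<integral>x. h x \<partial>weighted_law M g X) = (\<integral>x. h x \<partial>weighted_law N k Y)" by simp
  then show ?thesis
    using X(1) Y(1) g(2) k(2) weights_measurable h by (simp add: integral_weighted_law)
qed

definition mixed_product ::
    "('v \<Rightarrow> 'a \<Rightarrow> real) \<Rightarrow> 'v set \<Rightarrow> ('v \<Rightarrow> real set) \<Rightarrow> 'v set \<Rightarrow> ('v \<Rightarrow> nat) \<Rightarrow> 'a \<Rightarrow> real" where
  "mixed_product X I B J n \<omega> = (\<Prod>v\<in>I. indicator (B v) (X v \<omega>)) * (\<Prod>v\<in>J. X v \<omega> ^ n v)"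

lemma mixed_product_insert_power:
  assumes "finite J" "u \<notin> J"
  shows "mixed_product X I B (insert u J) (n(u := m)) \<omega> = X u \<omega> ^ m * mixed_product X I B J n \<omega>"
proof -
  have "(\<Prod>v\<in>J. X v \<omega> ^ (n(u := m)) v) = (\<Prod>v\<in>J. X v \<omega> ^ n v)"
    using assms(2) by (intro prod.cong) auto
  then show ?thesis using assms by (simp add: mixed_product_def)
qed

lemma mixed_product_unit_interval:
  assumes "\<And>v. v \<in> J \<Longrightarrow> X v \<omega> \<in> {0..1}"
  shows "mixed_product X I B J n \<omega> \<in> {0..1}"
proof -
  have "(\<Prod>v\<in>I. indicat_real (B v) (X v \<omega>)) \<le> 1" "(\<Prod>v\<in>J. X v \<omega> ^ n v) \<le> 1"
    using assms by (intro prod_le_1; simp add: power_le_one indicator_def)+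
  moreover have "0 \<le> (\<Prod>v\<in>I. indicat_real (B v) (X v \<omega>))" "0 \<le> (\<Prod>v\<in>J. X v \<omega> ^ n v)"
    using assms by (intro prod_nonneg; simp)+
  ultimately show ?thesis by (auto simp: mixed_product_def intro: mult_le_one)
qed

lemma integrable_mixed_product:
  assumes "finite_measure M"
    and X: "\<And>v. v \<in> I \<union> J \<Longrightarrow> X v \<in> borel_measurable M"
      "\<And>v \<omega>. v \<in> J \<Longrightarrow> X v \<omega> \<in> {0..1}"
    and B: "\<And>v. v \<in> I \<Longrightarrow> B v \<in> sets borel"
  shows "integrable M (mixed_product X I B J n)"
proof -
  interpret finite_measure M by fact
  have "(\<lambda>\<omega>. indicat_real (B v) (X v \<omega>)) \<in> borel_measurable M" if "v \<in> I" for v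
    using X(1)[of v] B[OF that] that
    by (intro measurable_compose[OF _ borel_measurable_indicator]) auto
  then have "mixed_product X I B J n \<in> borel_measurable M"
    unfolding mixed_product_def[abs_def] using X(1)
    by (intro borel_measurable_times borel_measurable_prod borel_measurable_power) auto
  then show ?thesis
    using mixed_product_unit_interval[of J X _ I B n] X(2)
    by (intro integrable_const_bound[where B=1]) auto
qed

text \<open>The variables are exchanged one at a time: moments of one variable under the measure weighted
  by all other factors are joint moments, so they determine the weighted law of that variable.\<close>
lemma integral_mixed_product_eqI_joint_moments:
  fixes X :: "'v \<Rightarrow> 'a \<Rightarrow> real" and Y :: "'v \<Rightarrow> 'b \<Rightarrow> real"
  assumes M: "finite_measure M" and N: "finite_measure N"
    and X: "\<And>v. v \<in> V \<Longrightarrow> X v \<in> borel_measurable M" "\<And>v \<omega>. v \<in> V \<Longrightarrow> X v \<omega> \<in> {0..1}"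
    and Y: "\<And>v. v \<in> V \<Longrightarrow> Y v \<in> borel_measurable N" "\<And>v \<omega>. v \<in> V \<Longrightarrow> Y v \<omega> \<in> {0..1}"
    and moments: "\<And>J n. finite J \<Longrightarrow> J \<subseteq> V \<Longrightarrow>
      (\<integral>\<omega>. (\<Prod>v\<in>J. X v \<omega> ^ n v) \<partial>M) = (\<integral>\<omega>. (\<Prod>v\<in>J. Y v \<omega> ^ n v) \<partial>N)"
    and I: "finite I" "I \<subseteq> V" "\<And>v. v \<in> I \<Longrightarrow> B v \<in> sets borel"
    and J: "finite J" "J \<subseteq> V" "I \<inter> J = {}"
  shows "(\<integral>\<omega>. mixed_product X I B J n \<omega> \<partial>M) = (\<integral>\<omega>. mixed_product Y I B J n \<omega> \<partial>N)"
  using I J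
proof (induction I arbitrary: J n rule: finite_induct)
  case empty
  then show ?case using moments by (simp add: mixed_product_def)
next
  case (insert u I)
  have sub: "insert u (I \<union> J) \<subseteq> V" using insert.prems by auto
  have "u \<notin> J" using insert.prems by blast
  have "(\<integral>\<omega>. indicat_real (B u) (X u \<omega>) * mixed_product X I B J n \<omega> \<partial>M)
      = (\<integral>\<omega>. indicator (B u) (Y u \<omega>) * mixed_product Y I B J n \<omega> \<partial>N)"
  proof (rule integral_comp_mult_eqI_moments[where X="X u" and Y="Y u" and B=1
        and h="indicator (B u)"])
    show "(\<integral>\<omega>. X u \<omega> ^ m * mixed_product X I B J n \<omega> \<partial>M)
        = (\<integral>\<omega>. Y u \<omega> ^ m * mixed_product Y I B J n \<omega> \<partial>N)" for m
      using insert.IH[of "insert u J" "n(u := m)"] insert.prems insert.hyps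
      unfolding mixed_product_insert_power[OF \<open>finite J\<close> \<open>u \<notin> J\<close>] by simp
    show "integrable M (mixed_product X I B J n)" "integrable N (mixed_product Y I B J n)"
      using sub X Y insert.prems M N by (auto intro!: integrable_mixed_product)
    show "AE \<omega> in M. 0 \<le> mixed_product X I B J n \<omega>" "AE \<omega> in N. 0 \<le> mixed_product Y I B J n \<omega>"
      using mixed_product_unit_interval[of J X] mixed_product_unit_interval[of J Y] X(2) Y(2) sub
      by (simp_all add: subset_iff)
  qed (use X[of u] Y[of u] sub insert.prems in auto)
  then show ?case using insert.hyps by (simp add: mixed_product_def mult_ac)
qed

lemma emeasure_distr_PiM_prod_emb:
  fixes X :: "'v \<Rightarrow> 'a \<Rightarrow> real"
  assumes "finite_measure M" and X: "\<And>v. v \<in> V \<Longrightarrow> X v \<in> borel_measurable M"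
    and I: "finite I" "I \<subseteq> V" "\<And>v. v \<in> I \<Longrightarrow> B v \<in> sets borel"
  shows "emeasure (distr M (Pi\<^sub>M V (\<lambda>_. borel)) (\<lambda>\<omega>. \<lambda>v\<in>V. X v \<omega>))
      (prod_emb V (\<lambda>_. borel) I (Pi\<^sub>E I B))
    = ennreal (\<integral>\<omega>. (\<Prod>v\<in>I. indicator (B v) (X v \<omega>)) \<partial>M)"
    (is "emeasure (distr M ?P ?f) ?box = _")
proof -
  interpret finite_measure M by fact
  let ?E = "{\<omega> \<in> space M. \<forall>v\<in>I. X v \<omega> \<in> B v}"
  have "emeasure (distr M ?P ?f) ?box = emeasure M (?f -` ?box \<inter> space M)"
    using X I by (intro emeasure_distr measurable_restrict sets_PiM_I) auto
  also have "?f -` ?box \<inter> space M = ?E"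
    using I(2) by (auto simp: prod_emb_iff PiE_iff subset_iff)
  also have "emeasure M ?E = ennreal (\<integral>\<omega>. indicator ?E \<omega> \<partial>M)"
    by (simp add: emeasure_eq_measure Int_absorb2 Collect_subset)
  also have "(\<integral>\<omega>. indicat_real ?E \<omega> \<partial>M) = (\<integral>\<omega>. (\<Prod>v\<in>I. indicator (B v) (X v \<omega>)) \<partial>M)"
    using I(1) by (intro Bochner_Integration.integral_cong) (auto simp: indicator_def)
  finally show ?thesis .
qed

lemma distr_PiM_eqI_joint_moments:
  fixes X :: "'v \<Rightarrow> 'a \<Rightarrow> real" and Y :: "'v \<Rightarrow> 'b \<Rightarrow> real"
  assumes M: "finite_measure M" and N: "finite_measure N"
    and X: "\<And>v. v \<in> V \<Longrightarrow> X v \<in> borel_measurable M" "\<And>v \<omega>. v \<in> V \<Longrightarrow> X v \<omega> \<in> {0..1}"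
    and Y: "\<And>v. v \<in> V \<Longrightarrow> Y v \<in> borel_measurable N" "\<And>v \<omega>. v \<in> V \<Longrightarrow> Y v \<omega> \<in> {0..1}"
    and moments: "\<And>J n. finite J \<Longrightarrow> J \<subseteq> V \<Longrightarrow>
      (\<integral>\<omega>. (\<Prod>v\<in>J. X v \<omega> ^ n v) \<partial>M) = (\<integral>\<omega>. (\<Prod>v\<in>J. Y v \<omega> ^ n v) \<partial>N)"
  shows "distr M (Pi\<^sub>M V (\<lambda>_. borel)) (\<lambda>\<omega>. \<lambda>v\<in>V. X v \<omega>)
       = distr N (Pi\<^sub>M V (\<lambda>_. borel)) (\<lambda>\<omega>. \<lambda>v\<in>V. Y v \<omega>)"
proof (rule measure_eqI_PiM_infinite)
  fix I B assume I: "finite I" "I \<subseteq> V" "\<And>v. v \<in> I \<Longrightarrow> B v \<in> sets (borel :: real measure)"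
  let ?box = "prod_emb V (\<lambda>_. borel :: real measure) I (Pi\<^sub>E I B)"
  have "(\<integral>\<omega>. (\<Prod>v\<in>I. indicat_real (B v) (X v \<omega>)) \<partial>M) = (\<integral>\<omega>. (\<Prod>v\<in>I. indicator (B v) (Y v \<omega>)) \<partial>N)"
    using integral_mixed_product_eqI_joint_moments[OF M N X Y moments I(1,2),
        where B=B and J="{}"] I(3)
    by (simp add: mixed_product_def)
  then show "emeasure (distr M (Pi\<^sub>M V (\<lambda>_. borel)) (\<lambda>\<omega>. \<lambda>v\<in>V. X v \<omega>)) ?box
      = emeasure (distr N (Pi\<^sub>M V (\<lambda>_. borel)) (\<lambda>\<omega>. \<lambda>v\<in>V. Y v \<omega>)) ?box"
    by (simp add: emeasure_distr_PiM_prod_emb[OF M X(1) I] emeasure_distr_PiM_prod_emb[OF N Y(1) I])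
qed (auto intro!: finite_measure.finite_measure_distr measurable_restrict M X)

section \<open>Differentiation under the integral sign\<close>

lemma norm_difference_quotient_le:
  fixes f f' :: "'b \<Rightarrow> 'b::real_normed_field"
  assumes "convex S" and "\<And>w. w \<in> S \<Longrightarrow> (f has_field_derivative f' w) (at w)"
    and "\<And>w. w \<in> S \<Longrightarrow> norm (f' w) \<le> B" and wz: "w \<in> S" "z \<in> S" "w \<noteq> z"
  shows "norm ((f w - f z) / (w - z)) \<le> B"
proof -
  have "norm (f w - f z) \<le> B * norm (w - z)"
    by (rule field_differentiable_bound[of S f f'])
      (use assms in \<open>auto intro: has_field_derivative_at_within\<close>)
  then show ?thesis using wz(3) by (simp add: norm_divide divide_le_eq)
qed

lemma has_field_derivative_integral:
  fixes f f' :: "'b \<Rightarrow> 'a \<Rightarrow> 'b::{real_normed_field, banach, second_countable_topology}"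
  assumes S: "open S" "convex S" "z \<in> S"
    and int: "\<And>w. w \<in> S \<Longrightarrow> integrable M (f w)"
    and deriv: "AE s in M. \<forall>w\<in>S. ((\<lambda>w. f w s) has_field_derivative f' w s) (at w)"
    and meas: "f' z \<in> borel_measurable M"
    and bound: "AE s in M. \<forall>w\<in>S. norm (f' w s) \<le> g s" and g: "integrable M g"
  shows "((\<lambda>w. \<integral>s. f w s \<partial>M) has_field_derivative (\<integral>s. f' z s \<partial>M)) (at z)"
proof -
  define quot where "quot w s = (f w s - f z s) / (w - z)" for w s
  have "((\<lambda>w. \<integral>s. quot w s \<partial>M) \<longlongrightarrow> (\<integral>s. f' z s \<partial>M)) (at z within S)"
    unfolding tendsto_at_iff_sequentially comp_def
  proof (intro allI impI)
    fix X assume "\<forall>i. X i \<in> S - {z}" and lim: "X \<longlonglongrightarrow> z"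
    then have X: "X i \<in> S" "X i \<noteq> z" for i by auto
    show "(\<lambda>i. \<integral>s. quot (X i) s \<partial>M) \<longlonglongrightarrow> (\<integral>s. f' z s \<partial>M)"
    proof (rule integral_dominated_convergence[OF meas _ g])
      show "quot (X i) \<in> borel_measurable M" for i
        unfolding quot_def[abs_def] using int[OF X(1)] int[OF S(3)] by measurable
      show "AE s in M. (\<lambda>i. quot (X i) s) \<longlonglongrightarrow> f' z s"
        using deriv
      proof eventually_elim
        case (elim s)
        then have "((\<lambda>w. quot w s) \<longlongrightarrow> f' z s) (at z)"
          using S(3) by (auto simp: quot_def has_field_derivative_iff)
        moreover have "filterlim X (at z) sequentially"
          using lim X(2) by (simp add: filterlim_at)
        ultimately show ?case by (rule filterlim_compose)
      qed
      show "AE s in M. norm (quot (X i) s) \<le> g s" for i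
        using deriv bound
      proof eventually_elim
        case (elim s)
        then show ?case
          unfolding quot_def using X S(2,3)
          by (intro norm_difference_quotient_le[of S "\<lambda>w. f w s" "\<lambda>w. f' w s"]) auto
      qed
    qed
  qed
  moreover have "(\<integral>s. quot w s \<partial>M) = ((\<integral>s. f w s \<partial>M) - (\<integral>s. f z s \<partial>M)) / (w - z)"
    if "w \<in> S" for w
    unfolding quot_def using int[OF that] int[OF S(3)] by simp
  ultimately have "((\<lambda>w. ((\<integral>s. f w s \<partial>M) - (\<integral>s. f z s \<partial>M)) / (w - z)) \<longlongrightarrow> (\<integral>s. f' z s \<partial>M))
      (at z within S)"
    by (simp cong: Lim_cong_within)
  then show ?thesis
    using at_within_open[OF S(3,1)] by (simp add: has_field_derivative_iff)
qed

section \<open>Levy measures\<close>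

lemma sets_levy_measure: "levy_measure \<rho> \<Longrightarrow> sets \<rho> = sets borel"
  by (simp add: levy_measure_def)

lemma levy_measure_AE_pos: "levy_measure \<rho> \<Longrightarrow> AE s in \<rho>. 0 < s"
  by (auto simp: levy_measure_def intro!: AE_I[where N="{..0}"])

lemma levy_measure_integrable_min:
  assumes levy: "levy_measure \<rho>"
  shows "integrable \<rho> (min 1)"
proof -
  note sets[measurable_cong] = sets_levy_measure[OF levy]
  have tail: "emeasure \<rho> {1/2<..} < \<infinity>"
    and small: "(\<integral>\<^sup>+ s. ennreal s * indicator {0<..<1} s \<partial>\<rho>) < \<infinity>"
    using levy by (auto simp: levy_measure_def)
  have "(\<integral>\<^sup>+ s. ennreal (min 1 s) \<partial>\<rho>)
      \<le> (\<integral>\<^sup>+ s. ennreal s * indicator {0<..<1} s + indicator {1/2<..} s \<partial>\<rho>)"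
    using levy_measure_AE_pos[OF levy]
    by (intro nn_integral_mono_AE)
       (auto elim!: eventually_mono split: split_indicator intro: ennreal_leI)
  also have "\<dots> = (\<integral>\<^sup>+ s. ennreal s * indicator {0<..<1} s \<partial>\<rho>) + emeasure \<rho> {1/2<..}"
    by (simp add: nn_integral_add sets)
  also have "\<dots> < \<infinity>" using tail small by simp
  finally show ?thesis
    using levy_measure_AE_pos[OF levy] by (intro integrableI_nonneg) (auto elim!: eventually_mono)
qed

lemma sigma_finite_measureI_finite_tails:
  fixes \<rho> :: "real measure"
  assumes sets: "sets \<rho> = sets borel" and null: "emeasure \<rho> {..0} = 0"
    and tail: "\<And>\<epsilon>. 0 < \<epsilon> \<Longrightarrow> emeasure \<rho> {\<epsilon><..} < \<infinity>"
  shows "sigma_finite_measure \<rho>"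
proof (rule sigma_finite_measure.intro, intro exI conjI ballI)
  let ?\<A> = "insert {..0} (range (\<lambda>n. {1 / real (Suc n)<..}))"
  show "countable ?\<A>" "?\<A> \<subseteq> sets \<rho>" by (auto simp: sets)
  have "x \<in> \<Union>?\<A>" for x :: real
    using reals_Archimedean[of x] by (cases "0 < x") (auto simp: inverse_eq_divide)
  then show "\<Union>?\<A> = space \<rho>" using sets_eq_imp_space_eq[OF sets] by auto
  show "emeasure \<rho> A \<noteq> \<infinity>" if "A \<in> ?\<A>" for A
    using that tail null by (auto simp: less_top[symmetric])
qed

lemma levy_measureI:
  assumes sets: "sets \<rho> = sets borel" and null: "emeasure \<rho> {..0} = 0"
    and int: "integrable \<rho> (min 1)"
  shows "levy_measure \<rho>"
proof -
  have [measurable_cong]: "sets \<rho> = sets borel" by fact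
  have pos: "AE s in \<rho>. 0 < s"
    by (rule AE_I[OF _ null]) (auto simp: sets)
  then have "AE s in \<rho>. 0 \<le> min 1 s" by eventually_elim simp
  then have "(\<integral>\<^sup>+ s. ennreal (min 1 s) \<partial>\<rho>) < \<infinity>"
    using nn_integral_eq_integral[OF int] by simp
  then have fin: "(\<integral>\<^sup>+ s. ennreal (C * min 1 s) \<partial>\<rho>) < \<infinity>" if "0 \<le> C" for C
    using that by (simp add: ennreal_mult' nn_integral_cmult ennreal_mult_less_top)
  have tail: "emeasure \<rho> {\<epsilon><..} < \<infinity>" if \<epsilon>_pos: "0 < \<epsilon>" for \<epsilon>
  proof -
    have "emeasure \<rho> {\<epsilon><..} = (\<integral>\<^sup>+ s. indicator {\<epsilon><..} s \<partial>\<rho>)" by simp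
    also have "\<dots> \<le> (\<integral>\<^sup>+ s. ennreal (1 / min 1 \<epsilon> * min 1 s) \<partial>\<rho>)"
      using pos \<epsilon>_pos by (intro nn_integral_mono_AE)
        (auto elim!: eventually_mono split: split_indicator simp: field_simps min_def)
    also have "\<dots> < \<infinity>" using \<epsilon>_pos by (intro fin) auto
    finally show ?thesis .
  qed
  have small: "(\<integral>\<^sup>+ s. ennreal s * indicator {0<..<\<epsilon>} s \<partial>\<rho>) < \<infinity>" for \<epsilon>
  proof -
    have "s \<le> max 1 \<epsilon> * min 1 s" if "0 < s" "s < \<epsilon>" for s
      using that by (auto simp: min_def max_def)
    then have "(\<integral>\<^sup>+ s. ennreal s * indicator {0<..<\<epsilon>} s \<partial>\<rho>)
        \<le> (\<integral>\<^sup>+ s. ennreal (max 1 \<epsilon> * min 1 s) \<partial>\<rho>)"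
      by (intro nn_integral_mono) (auto split: split_indicator intro: ennreal_leI)
    also have "\<dots> < \<infinity>" by (rule fin) simp
    finally show ?thesis .
  qed
  have "sigma_finite_measure \<rho>"
    using sets null tail by (rule sigma_finite_measureI_finite_tails)
  then show ?thesis using sets null tail small by (simp add: levy_measure_def)
qed

lemma levy_measure_integrableI:
  fixes f :: "real \<Rightarrow> 'b::{banach, second_countable_topology}"
  assumes levy: "levy_measure \<rho>" and "f \<in> borel_measurable borel"
    and bound: "\<And>s. 0 < s \<Longrightarrow> norm (f s) \<le> C * min 1 s"
  shows "integrable \<rho> f"
proof (rule Bochner_Integration.integrable_bound)
  show "integrable \<rho> (\<lambda>s. C * min 1 s)"
    using levy_measure_integrable_min[OF levy] by simp
  show "f \<in> borel_measurable \<rho>"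
    using assms(2) by (simp cong: measurable_cong_sets add: sets_levy_measure[OF levy])
  show "AE s in \<rho>. norm (f s) \<le> norm (C * min 1 s)"
    using levy_measure_AE_pos[OF levy]
    by eventually_elim (use bound order_trans abs_ge_self in fastforce)
qed

lemma scale_measure_eq_density: "scale_measure r M = density M (\<lambda>_. r)"
  by (intro measure_eqI) (auto simp: emeasure_density_const)

lemma levy_measure_scale:
  assumes levy: "levy_measure \<rho>" and c_nonneg: "0 \<le> c"
  shows "levy_measure (scale_measure (ennreal c) \<rho>)"
proof (rule levy_measureI)
  note [measurable_cong] = sets_levy_measure[OF levy]
  show "integrable (scale_measure (ennreal c) \<rho>) (min 1)"
    using levy_measure_integrable_min[OF levy] c_nonneg
    by (simp add: scale_measure_eq_density integrable_density)
qed (use levy in \<open>auto simp: levy_measure_def\<close>)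

lemma levy_measure_distr_divide:
  assumes levy: "levy_measure \<rho>" and c_pos: "0 < c"
  shows "levy_measure (distr \<rho> borel (\<lambda>s. s / c))"
proof (rule levy_measureI)
  have sets[measurable_cong]: "sets \<rho> = sets borel" and null: "emeasure \<rho> {..0} = 0"
    using levy by (simp_all add: levy_measure_def)
  have "(\<lambda>s. s / c) -` {..0} = {..0}" using c_pos by (auto simp: divide_le_0_iff)
  then show "emeasure (distr \<rho> borel (\<lambda>s. s / c)) {..0} = 0"
    using null sets_eq_imp_space_eq[OF sets] by (simp add: emeasure_distr)
  have "integrable \<rho> (\<lambda>s. min 1 (s / c))"
  proof (rule levy_measure_integrableI[OF levy])
    show "norm (min 1 (s / c)) \<le> max 1 (1 / c) * min 1 s" if "0 < s" for s
      using that c_pos by (auto simp: min_def max_def field_simps)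
  qed measurable
  then show "integrable (distr \<rho> borel (\<lambda>s. s / c)) (min 1)" by (simp add: integrable_distr_eq)
qed simp

section \<open>Laplace exponents\<close>

definition laplace_exp_complex :: "real measure \<Rightarrow> complex \<Rightarrow> complex" where
  "laplace_exp_complex \<rho> z = (\<integral>s. 1 - exp (- z * of_real s) \<partial>\<rho>)"

lemma norm_one_minus_exp_uminus_le:
  fixes z :: complex
  assumes "0 \<le> Re z"
  shows "norm (1 - exp (- z)) \<le> norm z"
proof -
  have "norm (exp (- 0) - exp (- z)) \<le> 1 * norm (0 - z)"
  proof (rule field_differentiable_bound[where f="\<lambda>z. exp (- z)" and S="{w. 0 \<le> Re w}"])
    show "((\<lambda>z. exp (- z)) has_field_derivative - exp (- w)) (at w within {w. 0 \<le> Re w})"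
      for w :: complex
      by (auto intro!: derivative_eq_intros)
  qed (use assms in \<open>auto simp: convex_halfspace_Re_ge\<close>)
  then show ?thesis by simp
qed

lemma levy_measure_integrable_one_minus_exp:
  assumes levy: "levy_measure \<rho>" and Re_z: "0 \<le> Re z"
  shows "integrable \<rho> (\<lambda>s. 1 - exp (- z * of_real s))"
proof (rule levy_measure_integrableI[OF levy])
  fix s :: real assume s_pos: "0 < s"
  have "norm (1 - exp (- (z * of_real s))) \<le> norm (z * of_real s)"
    using s_pos Re_z by (intro norm_one_minus_exp_uminus_le) simp
  also have "\<dots> \<le> max 2 (norm z) * s" using s_pos by (simp add: norm_mult mult_right_mono)
  finally have linear: "norm (1 - exp (- (z * of_real s))) \<le> max 2 (norm z) * s" .
  have "norm (1 - exp (- (z * of_real s))) \<le> norm (1::complex) + norm (exp (- (z * of_real s)))"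
    by (rule norm_triangle_ineq4)
  also have "\<dots> \<le> 1 + 1" using s_pos Re_z by simp
  finally have "norm (1 - exp (- (z * of_real s))) \<le> max 2 (norm z)" by simp
  with linear show "norm (1 - exp (- z * of_real s)) \<le> max 2 (norm z) * min 1 s"
    by (simp add: min_def)
qed measurable

lemma mult_exp_uminus_le_min:
  fixes s u :: real
  assumes "0 < s" "0 < u"
  shows "s * exp (- u * s) \<le> max 1 (1 / u) * min 1 s"
proof (cases "s \<le> 1")
  case True
  have "s * exp (- u * s) \<le> s * 1" using assms by (intro mult_left_mono) auto
  also have "\<dots> \<le> max 1 (1 / u) * s" using mult_right_mono[of 1 "max 1 (1 / u)" s] assms by simp
  finally show ?thesis using True by simp
next
  case False
  have "u * s \<le> exp (u * s)" using exp_ge_add_one_self[of "u * s"] by linarith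
  then have "s * exp (- u * s) \<le> 1 / u" using assms by (simp add: exp_minus field_simps)
  then show ?thesis using False by (simp add: le_max_iff_disj)
qed

lemma levy_measure_integrable_mult_exp:
  assumes "levy_measure \<rho>" "0 < u"
  shows "integrable \<rho> (\<lambda>s. s * exp (- u * s))"
  using assms mult_exp_uminus_le_min
  by (intro levy_measure_integrableI[where C="max 1 (1 / u)"]) auto

lemma laplace_exp_complex_has_field_derivative:
  assumes levy: "levy_measure \<rho>" and Re_z: "0 < Re z"
  shows "(laplace_exp_complex \<rho> has_field_derivative
    (\<integral>s. of_real s * exp (- z * of_real s) \<partial>\<rho>)) (at z)"
  unfolding laplace_exp_complex_def[abs_def]
proof (rule has_field_derivative_integral[where S="{w. Re z / 2 < Re w}"])
  note [measurable_cong] = sets_levy_measure[OF levy]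
  show "integrable \<rho> (\<lambda>s. s * exp (- (Re z / 2) * s))"
    using levy Re_z by (intro levy_measure_integrable_mult_exp) auto
  show "integrable \<rho> (\<lambda>s. 1 - exp (- w * of_real s))" if "w \<in> {w. Re z / 2 < Re w}" for w
    using levy Re_z that by (intro levy_measure_integrable_one_minus_exp) auto
  show "AE s in \<rho>. \<forall>w\<in>{w. Re z / 2 < Re w}.
      ((\<lambda>w. 1 - exp (- w * of_real s)) has_field_derivative
        of_real s * exp (- w * of_real s)) (at w)"
    by (auto intro!: derivative_eq_intros)
  show "AE s in \<rho>. \<forall>w\<in>{w. Re z / 2 < Re w}.
      norm (of_real s * exp (- w * of_real s)) \<le> s * exp (- (Re z / 2) * s)"
    using levy_measure_AE_pos[OF levy]
  proof eventually_elim
    case (elim s)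
    then show ?case by (auto simp: norm_mult)
  qed
  show "open {w. Re z / 2 < Re w}" by (rule open_halfspace_Re_gt)
  show "convex {w. Re z / 2 < Re w}" by (rule convex_halfspace_Re_gt)
  show "z \<in> {w. Re z / 2 < Re w}" using Re_z by simp
  show "(\<lambda>s. of_real s * exp (- z * of_real s)) \<in> borel_measurable \<rho>" by measurable
qed

lemma laplace_exp_complex_of_real: "laplace_exp_complex \<rho> (of_real t) = of_real (laplace_exp \<rho> t)"
proof -
  have "1 - exp (- complex_of_real t * of_real s) = of_real (1 - exp (- t * s))" for s
    by (simp flip: exp_of_real)
  then show ?thesis
    by (simp only: laplace_exp_complex_def laplace_exp_def integral_complex_of_real)
qed

definition laplace_exp_deriv :: "real measure \<Rightarrow> real \<Rightarrow> real" where
  "laplace_exp_deriv \<rho> t = (\<integral>s. s * exp (- t * s) \<partial>\<rho>)"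

lemma laplace_exp_has_real_derivative:
  assumes "levy_measure \<rho>" "0 < t"
  shows "(laplace_exp \<rho> has_real_derivative laplace_exp_deriv \<rho> t) (at t)"
proof -
  have "complex_of_real s * exp (- complex_of_real t * of_real s) = of_real (s * exp (- t * s))"
    for s by (simp flip: exp_of_real)
  then have "(\<integral>s. complex_of_real s * exp (- complex_of_real t * of_real s) \<partial>\<rho>)
      = of_real (laplace_exp_deriv \<rho> t)"
    by (simp only: laplace_exp_deriv_def integral_complex_of_real)
  then have "(laplace_exp_complex \<rho> has_field_derivative of_real (laplace_exp_deriv \<rho> t))
      (at (of_real t))"
    using laplace_exp_complex_has_field_derivative[of \<rho> "of_real t"] assms by simp
  then have "((\<lambda>t. complex_of_real (laplace_exp \<rho> t)) has_vector_derivative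
      of_real (laplace_exp_deriv \<rho> t)) (at t)"
    unfolding laplace_exp_complex_of_real[symmetric] by (rule has_vector_derivative_real_field)
  then show ?thesis
    by (simp add: has_vector_derivative_complex_iff has_real_derivative_iff_has_vector_derivative)
qed

lemma laplace_exp_zero [simp]: "laplace_exp \<rho> 0 = 0"
  by (simp add: laplace_exp_def)

lemma levy_measure_integrable_one_minus_exp_real:
  assumes "levy_measure \<rho>" "0 \<le> t"
  shows "integrable \<rho> (\<lambda>s. 1 - exp (- t * s))"
  using integrable_Re[OF levy_measure_integrable_one_minus_exp[of \<rho> "of_real t"]] assms
  by (simp add: exp_of_real flip: of_real_mult of_real_minus)

lemma laplace_exp_continuous_on:
  assumes levy: "levy_measure \<rho>"
  shows "continuous_on {0..} (laplace_exp \<rho>)"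
proof (rule continuous_on_sequentiallyI)
  fix u :: "nat \<Rightarrow> real" and a
  assume u: "\<forall>n. u n \<in> {0..}" and lim: "u \<longlonglongrightarrow> a"
  note [measurable_cong] = sets_levy_measure[OF levy]
  obtain T where T: "\<And>n. u n \<le> T"
    using convergent_imp_Bseq[OF convergentI[OF lim]] by (auto simp: Bseq_def abs_le_iff)
  then have "0 \<le> T" using u order_trans by (metis atLeast_iff)
  show "(\<lambda>n. laplace_exp \<rho> (u n)) \<longlonglongrightarrow> laplace_exp \<rho> a"
    unfolding laplace_exp_def
  proof (rule integral_dominated_convergence)
    show "integrable \<rho> (\<lambda>s. 1 - exp (- T * s))"
      using levy \<open>0 \<le> T\<close> by (rule levy_measure_integrable_one_minus_exp_real)
    show "AE s in \<rho>. (\<lambda>n. 1 - exp (- u n * s)) \<longlonglongrightarrow> 1 - exp (- a * s)"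
      by (intro AE_I2 tendsto_intros lim)
    show "AE s in \<rho>. norm (1 - exp (- u n * s)) \<le> 1 - exp (- T * s)" for n
      using levy_measure_AE_pos[OF levy]
    proof eventually_elim
      case (elim s)
      have "0 \<le> u n * s" "u n * s \<le> T * s" using u T elim by (auto intro: mult_right_mono)
      then show ?case by auto
    qed
  qed measurable
qed

lemma integral_pos_if_AE_pos:
  fixes f :: "'a \<Rightarrow> real"
  assumes int: "integrable M f" and pos: "AE x in M. 0 < f x" and "emeasure M (space M) \<noteq> 0"
  shows "0 < (\<integral>x. f x \<partial>M)"
proof -
  have nonneg: "AE x in M. 0 \<le> f x" using pos by eventually_elim simp
  have "(\<integral>x. f x \<partial>M) \<noteq> 0"
  proof
    assume "(\<integral>x. f x \<partial>M) = 0"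
    then have "AE x in M. f x = 0" using integral_nonneg_eq_0_iff_AE[OF int nonneg] by simp
    with pos have "AE x in M. False" by eventually_elim simp
    then show False using assms(3) by (simp add: AE_iff_null null_sets_def)
  qed
  moreover have "0 \<le> (\<integral>x. f x \<partial>M)" using nonneg by (rule integral_nonneg_AE)
  ultimately show ?thesis by simp
qed

lemma emeasure_space_eq_0_iff_null_measure:
  assumes "sets M = sets N"
  shows "emeasure M (space M) = 0 \<longleftrightarrow> M = null_measure N"
proof
  assume "emeasure M (space M) = 0"
  then have "emeasure M A = 0" for A using emeasure_space[of M A] by simp
  then show "M = null_measure N" using assms by (intro measure_eqI) simp_all
qed simp

lemma levy_measure_integral_pos:
  fixes f :: "real \<Rightarrow> real"
  assumes levy: "levy_measure \<rho>" and nontriv: "\<rho> \<noteq> null_measure borel"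
    and "integrable \<rho> f" and pos: "\<And>s. 0 < s \<Longrightarrow> 0 < f s"
  shows "0 < (\<integral>s. f s \<partial>\<rho>)"
proof (rule integral_pos_if_AE_pos)
  show "AE s in \<rho>. 0 < f s" using levy_measure_AE_pos[OF levy] by eventually_elim (rule pos)
  show "emeasure \<rho> (space \<rho>) \<noteq> 0"
    using nontriv by (simp add: emeasure_space_eq_0_iff_null_measure[OF sets_levy_measure[OF levy]])
qed fact

lemma laplace_exp_nonneg: "levy_measure \<rho> \<Longrightarrow> 0 \<le> t \<Longrightarrow> 0 \<le> laplace_exp \<rho> t"
  unfolding laplace_exp_def
  by (rule integral_nonneg_AE, drule levy_measure_AE_pos, erule eventually_mono) simp

lemma laplace_exp_pos:
  assumes "levy_measure \<rho>" "\<rho> \<noteq> null_measure borel" "0 < t"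
  shows "0 < laplace_exp \<rho> t"
  unfolding laplace_exp_def using assms
  by (intro levy_measure_integral_pos levy_measure_integrable_one_minus_exp_real) auto

lemma laplace_exp_deriv_pos:
  assumes "levy_measure \<rho>" "\<rho> \<noteq> null_measure borel" "0 < t"
  shows "0 < laplace_exp_deriv \<rho> t"
  unfolding laplace_exp_deriv_def using assms
  by (intro levy_measure_integral_pos levy_measure_integrable_mult_exp) auto

lemma laplace_exp_scale:
  assumes [measurable_cong]: "sets \<rho> = sets borel" and "0 \<le> c"
  shows "laplace_exp (scale_measure (ennreal c) \<rho>) t = c * laplace_exp \<rho> t"
  unfolding laplace_exp_def scale_measure_eq_density using assms(2)
  by (simp add: integral_density)

lemma laplace_exp_distr_divide:
  assumes "sets \<rho> = sets borel"
  shows "laplace_exp (distr \<rho> borel (\<lambda>s. s / c)) t = laplace_exp \<rho> (t / c)"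
  unfolding laplace_exp_def using assms by (subst integral_distr) (auto cong: measurable_cong_sets)

section \<open>Injectivity of the Laplace exponent\<close>

definition levy_tilt :: "real measure \<Rightarrow> real measure" where
  "levy_tilt \<rho> = density \<rho> (\<lambda>s. ennreal (s * exp (- s)))"

lemma sets_levy_tilt: "levy_measure \<rho> \<Longrightarrow> sets (levy_tilt \<rho>) = sets borel"
  by (simp add: levy_tilt_def sets_levy_measure)

lemma finite_measure_levy_tilt:
  assumes levy: "levy_measure \<rho>"
  shows "finite_measure (levy_tilt \<rho>)"
proof (rule finite_measureI)
  note [measurable_cong] = sets_levy_measure[OF levy]
  have "AE s in \<rho>. 0 \<le> s * exp (- s)"
    using levy_measure_AE_pos[OF levy] by eventually_elim simp
  then have "(\<integral>\<^sup>+ s. ennreal (s * exp (- s)) \<partial>\<rho>) < \<infinity>"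
    using nn_integral_eq_integral[of \<rho> "\<lambda>s. s * exp (- s)"]
      levy_measure_integrable_mult_exp[OF levy, of 1] by simp
  then show "emeasure (levy_tilt \<rho>) (space (levy_tilt \<rho>)) \<noteq> \<infinity>"
    by (simp add: levy_tilt_def emeasure_density cong: nn_integral_cong)
qed

lemma density_levy_tilt:
  assumes levy: "levy_measure \<rho>"
  shows "density (levy_tilt \<rho>) (\<lambda>s. ennreal (1 / (s * exp (- s)))) = \<rho>"
proof -
  note [measurable_cong] = sets_levy_measure[OF levy]
  have "density (levy_tilt \<rho>) (\<lambda>s. ennreal (1 / (s * exp (- s)))) = density \<rho> (\<lambda>_. ennreal 1)"
    unfolding levy_tilt_def using levy_measure_AE_pos[OF levy]
    by (intro density_density_divide) (auto elim!: eventually_mono)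
  then show ?thesis by (simp add: density_1)
qed

lemma has_field_derivative_char_levy_tilt:
  assumes levy: "levy_measure \<rho>"
  shows "(laplace_exp_complex \<rho> has_field_derivative char (levy_tilt \<rho>) t) (at (1 - \<i> * of_real t))"
proof -
  note [measurable_cong] = sets_levy_measure[OF levy]
  have "char (levy_tilt \<rho>) t = (\<integral>s. (s * exp (- s)) *\<^sub>R iexp (t * s) \<partial>\<rho>)"
    unfolding levy_tilt_def char_def using levy_measure_AE_pos[OF levy]
    by (intro integral_density) (auto elim!: eventually_mono)
  also have "\<dots> = (\<integral>s. of_real s * exp (- (1 - \<i> * of_real t) * of_real s) \<partial>\<rho>)"
    by (simp add: scaleR_conv_of_real algebra_simps exp_diff exp_minus exp_of_real divide_inverse)
  finally show ?thesis
    using laplace_exp_complex_has_field_derivative[OF levy, of "1 - \<i> * of_real t"] by simp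
qed

lemma laplace_exp_complex_eqI:
  assumes levy: "levy_measure \<rho>" and levy': "levy_measure \<rho>'" and r_pos: "0 < r"
    and eq: "\<And>x. 0 < x \<Longrightarrow> x < r \<Longrightarrow> laplace_exp \<rho> x = laplace_exp \<rho>' x"
    and Re_z: "0 < Re z"
  shows "laplace_exp_complex \<rho> z = laplace_exp_complex \<rho>' z"
proof -
  let ?H = "{w. 0 < Re w}" and ?U = "complex_of_real ` {0<..<r}"
  have holomorphic: "laplace_exp_complex \<nu> holomorphic_on ?H" if "levy_measure \<nu>" for \<nu>
    using laplace_exp_complex_has_field_derivative[OF that]
    by (auto simp: holomorphic_on_open open_halfspace_Re_gt)
  have "laplace_exp_complex \<rho> z - laplace_exp_complex \<rho>' z = 0"
  proof (rule analytic_continuation[where U="?U" and S="?H" and \<xi>="of_real (r / 2)"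
        and f="\<lambda>z. laplace_exp_complex \<rho> z - laplace_exp_complex \<rho>' z"])
    show "(\<lambda>z. laplace_exp_complex \<rho> z - laplace_exp_complex \<rho>' z) holomorphic_on ?H"
      using levy levy' by (intro holomorphic_intros holomorphic)
    show "complex_of_real (r / 2) islimpt ?U"
      using r_pos by (intro islimpt_isCont_image interior_limit_point)
        (auto simp: eventually_at_filter simp del: of_real_divide)
    show "laplace_exp_complex \<rho> w - laplace_exp_complex \<rho>' w = 0" if "w \<in> ?U" for w
      using that eq by (auto simp: laplace_exp_complex_of_real)
  qed (use Re_z r_pos in \<open>auto simp: open_halfspace_Re_gt
      intro!: convex_connected convex_halfspace_Re_gt\<close>)
  then show ?thesis by simp
qed

theorem laplace_exp_inject:
  assumes levy: "levy_measure \<rho>" and levy': "levy_measure \<rho>'" and "0 < r"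
    and "\<And>x. 0 < x \<Longrightarrow> x < r \<Longrightarrow> laplace_exp \<rho> x = laplace_exp \<rho>' x"
  shows "\<rho> = \<rho>'"
proof -
  have "levy_tilt \<rho> = levy_tilt \<rho>'"
  proof (rule finite_measure_eqI_char)
    show "char (levy_tilt \<rho>) = char (levy_tilt \<rho>')"
    proof
      fix t
      have "(laplace_exp_complex \<rho>' has_field_derivative char (levy_tilt \<rho>) t)
          (at (1 - \<i> * of_real t))"
        using has_field_derivative_char_levy_tilt[OF levy] open_halfspace_Re_gt[of 0]
        by (rule has_field_derivative_transform_within_open)
           (auto intro: laplace_exp_complex_eqI[OF assms])
      then show "char (levy_tilt \<rho>) t = char (levy_tilt \<rho>') t"
        using has_field_derivative_char_levy_tilt[OF levy'] by (rule DERIV_unique)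
    qed
  qed (use levy levy' in \<open>simp_all add: finite_measure_levy_tilt sets_levy_tilt\<close>)
  then show ?thesis using density_levy_tilt[OF levy] density_levy_tilt[OF levy'] by metis
qed

section \<open>Laws of vectors of random measures\<close>

lemma expneg_unit_interval: "0 \<le> t \<Longrightarrow> expneg t x \<in> {0..1}"
  by (auto simp: expneg_def)

lemma expneg_zero_left [simp]: "expneg 0 x = 1"
  by (simp add: expneg_def)

lemma expneg_zero_right [simp]: "expneg t 0 = 1"
  by (simp add: expneg_def)

lemma expneg_add_left: "0 \<le> a \<Longrightarrow> 0 \<le> b \<Longrightarrow> expneg (a + b) x = expneg a x * expneg b x"
  by (auto simp: expneg_def algebra_simps exp_add[symmetric])

lemma expneg_add_right: "expneg t (x + y) = expneg t x * expneg t y"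
  by (auto simp: expneg_def enn2real_plus less_top algebra_simps exp_add[symmetric])

lemma expneg_sum_left:
  "finite I \<Longrightarrow> (\<And>i. i \<in> I \<Longrightarrow> 0 \<le> a i) \<Longrightarrow> expneg (\<Sum>i\<in>I. a i) x = (\<Prod>i\<in>I. expneg (a i) x)"
  by (induction I rule: finite_induct) (auto simp: expneg_add_left sum_nonneg)

lemma expneg_sum_right: "finite J \<Longrightarrow> expneg t (\<Sum>j\<in>J. x j) = (\<Prod>j\<in>J. expneg t (x j))"
  by (induction J rule: finite_induct) (auto simp: expneg_add_right)

lemma expneg_power: "expneg t x ^ n = expneg (real n * t) x"
  by (auto simp: expneg_def power_0_left exp_of_nat_mult[symmetric])

lemma borel_measurable_expneg [measurable]: "expneg t \<in> borel_measurable borel"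
  unfolding expneg_def[abs_def] by measurable

definition neglog :: "real \<Rightarrow> ennreal" where
  "neglog x = (if x \<le> 0 then \<infinity> else ennreal (- ln x))"

lemma borel_measurable_neglog [measurable]: "neglog \<in> borel_measurable borel"
  unfolding neglog_def[abs_def] by measurable

lemma neglog_expneg [simp]: "neglog (expneg 1 x) = x"
  by (auto simp: neglog_def expneg_def less_top)

lemma space_rm_space: "space (rm_space d) = {m. \<forall>i\<in>{1..d}. m i \<in> bfm}"
  unfolding rm_space_def by (rule space_measure_of) auto

lemma sets_rm_space: "sets (rm_space d) = sigma_sets {m. \<forall>i\<in>{1..d}. m i \<in> bfm}
     {{m. \<forall>i\<in>{1..d}. m i \<in> bfm} \<inter> {m. emeasure (m i) A \<in> B} | i A B.
        i \<in> {1..d} \<and> A \<in> sets borel \<and> B \<in> sets (borel :: ennreal measure)}"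
  unfolding rm_space_def by (rule sets_measure_of) auto

lemma borel_measurable_emeasure_rm_space:
  assumes "i \<in> {1..d}" "A \<in> sets borel"
  shows "(\<lambda>m. emeasure (m i) A) \<in> borel_measurable (rm_space d)"
proof (rule measurableI)
  fix B :: "ennreal set" assume B: "B \<in> sets borel"
  have "(\<lambda>m. emeasure (m i) A) -` B \<inter> space (rm_space d)
      = {m. \<forall>i\<in>{1..d}. m i \<in> bfm} \<inter> {m. emeasure (m i) A \<in> B}"
    by (auto simp: space_rm_space)
  also have "\<dots> \<in> sets (rm_space d)"
    unfolding sets_rm_space using assms B by (blast intro: sigma_sets.Basic)
  finally show "(\<lambda>m. emeasure (m i) A) -` B \<inter> space (rm_space d) \<in> sets (rm_space d)" .
qed simp

text \<open>The substitution \<open>x \<mapsto> exp (- x)\<close> loses no information and makes all evaluations bounded.\<close>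
definition laplace_evals ::
    "nat \<Rightarrow> (nat \<Rightarrow> ('x::polish_space) measure) \<Rightarrow> nat \<times> 'x set \<Rightarrow> real" where
  "laplace_evals d m = (\<lambda>(i, A)\<in>{1..d} \<times> sets borel. expneg 1 (emeasure (m i) A))"

lemma sets_rm_space_subset_vimage:
  "sets (rm_space d) \<subseteq> sets (vimage_algebra (space (rm_space d)) (laplace_evals d)
     (Pi\<^sub>M ({1..d} \<times> sets (borel :: ('x::polish_space) measure)) (\<lambda>_. borel)))"
  (is "_ \<subseteq> sets ?V")
  unfolding sets_rm_space
proof (rule sets.sigma_sets_subset')
  let ?\<Omega> = "{m :: nat \<Rightarrow> 'x measure. \<forall>i\<in>{1..d}. m i \<in> bfm}"
  show "?\<Omega> \<in> sets ?V" using sets_vimage_algebra_space[of ?\<Omega>] by (simp add: space_rm_space)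
  show "{?\<Omega> \<inter> {m. emeasure (m i) A \<in> B} | i A B.
      i \<in> {1..d} \<and> A \<in> sets borel \<and> B \<in> sets (borel :: ennreal measure)} \<subseteq> sets ?V"
  proof safe
    fix i :: nat and A :: "'x set" and B :: "ennreal set"
    assume iAB: "i \<in> {1..d}" "A \<in> sets borel" "B \<in> sets borel"
    have evals: "laplace_evals d \<in> measurable ?V (Pi\<^sub>M ({1..d} \<times> sets borel) (\<lambda>_. borel))"
      by (rule measurable_vimage_algebra1) (auto simp: laplace_evals_def space_PiM)
    have "(\<lambda>m. laplace_evals d m (i, A)) \<in> borel_measurable ?V"
      using iAB by (intro measurable_compose[OF evals measurable_component_singleton]) auto
    then have "(\<lambda>m. neglog (laplace_evals d m (i, A))) \<in> borel_measurable ?V"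
      by (rule measurable_compose) measurable
    from measurable_sets[OF this iAB(3)]
    have "(\<lambda>m. neglog (laplace_evals d m (i, A))) -` B \<inter> ?\<Omega> \<in> sets ?V"
      by (simp add: space_rm_space)
    also have "(\<lambda>m. neglog (laplace_evals d m (i, A))) -` B \<inter> ?\<Omega>
        = ?\<Omega> \<inter> {m. emeasure (m i) A \<in> B}"
      using iAB by (auto simp: laplace_evals_def)
    finally show "?\<Omega> \<inter> {m. emeasure (m i) A \<in> B} \<in> sets ?V" .
  qed
qed

lemma measurable_laplace_evals:
  "laplace_evals d \<in> measurable (rm_space d)
    (Pi\<^sub>M ({1..d} \<times> sets (borel :: ('x::polish_space) measure)) (\<lambda>_. borel))"
  unfolding laplace_evals_def
  by (intro measurable_restrict)
     (auto intro!:
        measurable_compose[OF borel_measurable_emeasure_rm_space borel_measurable_expneg])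

lemma rm_space_measure_eqI_laplace_evals:
  fixes M N :: "(nat \<Rightarrow> ('x::polish_space) measure) measure"
  assumes M: "sets M = sets (rm_space d)" and N: "sets N = sets (rm_space d)"
    and eq: "distr M (Pi\<^sub>M ({1..d} \<times> sets borel) (\<lambda>_. borel)) (laplace_evals d)
           = distr N (Pi\<^sub>M ({1..d} \<times> sets borel) (\<lambda>_. borel)) (laplace_evals d)"
      (is "distr M ?P _ = distr N ?P _")
  shows "M = N"
proof (rule measure_eqI)
  show "sets M = sets N" using M N by simp
  have "laplace_evals d \<in> space (rm_space d) \<rightarrow> space ?P"
    by (auto simp: laplace_evals_def space_PiM)
  note vimage = sets_vimage_algebra2[OF this]
  fix E assume "E \<in> sets M"
  then have "E \<in> {laplace_evals d -` B \<inter> space (rm_space d) | B. B \<in> sets ?P}"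
    unfolding M vimage[symmetric] by (rule subsetD[OF sets_rm_space_subset_vimage])
  then obtain B where B: "B \<in> sets ?P" and E: "E = laplace_evals d -` B \<inter> space (rm_space d)"
    by blast
  have preimage: "emeasure K E = emeasure (distr K ?P (laplace_evals d)) B"
    if "sets K = sets (rm_space d)" for K
    using that measurable_laplace_evals[of d] B sets_eq_imp_space_eq[OF that]
    by (subst emeasure_distr) (auto simp: E cong: measurable_cong_sets)
  show "emeasure M E = emeasure N E" unfolding preimage[OF M] preimage[OF N] eq ..
qed

definition joint_laplace ::
    "'a measure \<Rightarrow> nat \<Rightarrow> ('a \<Rightarrow> nat \<Rightarrow> ('x::polish_space) measure) \<Rightarrow> nat \<Rightarrow> (nat \<Rightarrow> 'x set) \<Rightarrow>
      (nat \<Rightarrow> nat \<Rightarrow> real) \<Rightarrow> real" where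
  "joint_laplace M d \<mu> k A lam =
     (\<integral>\<omega>. (\<Prod>i\<in>{1..d}. \<Prod>j<k. expneg (lam i j) (emeasure (\<mu> \<omega> i) (A j))) \<partial>M)"

lemma joint_laplace_eq_if_eq_dist:
  fixes \<mu>1 :: "'a \<Rightarrow> nat \<Rightarrow> ('x::polish_space) measure" and \<mu>2 :: "'b \<Rightarrow> nat \<Rightarrow> 'x measure"
  assumes \<mu>1: "\<mu>1 \<in> measurable M1 (rm_space d)" and \<mu>2: "\<mu>2 \<in> measurable M2 (rm_space d)"
    and eq: "eq_dist d M1 \<mu>1 M2 \<mu>2" and A: "A ` {..<k} \<subseteq> sets borel"
  shows "joint_laplace M1 d \<mu>1 k A lam = joint_laplace M2 d \<mu>2 k A lam"
proof -
  define f where "f m = (\<Prod>i\<in>{1..d}. \<Prod>j<k. expneg (lam i j) (emeasure (m i) (A j)))"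
    for m :: "nat \<Rightarrow> 'x measure"
  have f: "f \<in> borel_measurable (rm_space d)"
    unfolding f_def[abs_def] using A
    by (intro borel_measurable_prod
        measurable_compose[OF borel_measurable_emeasure_rm_space borel_measurable_expneg]) auto
  have "(\<integral>\<omega>. f (\<mu>1 \<omega>) \<partial>M1) = (\<integral>m. f m \<partial>distr M1 (rm_space d) \<mu>1)"
    by (rule integral_distr[OF \<mu>1 f, symmetric])
  also have "\<dots> = (\<integral>m. f m \<partial>distr M2 (rm_space d) \<mu>2)" using eq by (simp only: eq_dist_def)
  also have "\<dots> = (\<integral>\<omega>. f (\<mu>2 \<omega>) \<partial>M2)" by (rule integral_distr[OF \<mu>2 f])
  finally show ?thesis by (simp add: joint_laplace_def f_def)
qed

definition membership_atom :: "'a measure \<Rightarrow> 'a set set \<Rightarrow> 'a set set \<Rightarrow> 'a set" where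
  "membership_atom M \<A> T = {x \<in> space M. \<forall>A\<in>\<A>. x \<in> A \<longleftrightarrow> A \<in> T}"

lemma sets_membership_atom:
  assumes "finite \<A>" "\<A> \<subseteq> sets M"
  shows "membership_atom M \<A> T \<in> sets M"
  unfolding membership_atom_def
proof (rule sets.sets_Collect_finite_All[OF _ assms(1)])
  fix A assume "A \<in> \<A>"
  then have [measurable]: "A \<in> sets M" using assms(2) by blast
  show "{x \<in> space M. x \<in> A \<longleftrightarrow> A \<in> T} \<in> sets M" by measurable
qed

lemma membership_atom_disjoint:
  assumes "S \<subseteq> \<A>" "T \<subseteq> \<A>" "S \<noteq> T"
  shows "membership_atom M \<A> S \<inter> membership_atom M \<A> T = {}"
  using assms unfolding membership_atom_def by blast

lemma eq_Union_membership_atoms: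
  assumes A: "A \<in> \<A>" "A \<subseteq> space M"
  shows "A = \<Union>{membership_atom M \<A> T | T. T \<subseteq> \<A> \<and> membership_atom M \<A> T \<subseteq> A}"
proof (intro equalityI subsetI)
  fix x assume "x \<in> A"
  let ?T = "{A \<in> \<A>. x \<in> A}"
  have "x \<in> membership_atom M \<A> ?T" "membership_atom M \<A> ?T \<subseteq> A"
    using A \<open>x \<in> A\<close> by (auto simp: membership_atom_def)
  then show "x \<in> \<Union>{membership_atom M \<A> T | T. T \<subseteq> \<A> \<and> membership_atom M \<A> T \<subseteq> A}"
    by (intro UnionI CollectI exI[of _ ?T] conjI refl) auto
qed blast

lemma finite_family_disjoint_refinement:
  assumes "finite \<A>" "\<A> \<subseteq> sets M"
  obtains C :: "nat \<Rightarrow> 'a set" and k :: nat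
  where "disjoint_family_on C {..<k}" "C ` {..<k} \<subseteq> sets M"
    "\<forall>A\<in>\<A>. A = (\<Union>j\<in>{j. j < k \<and> C j \<subseteq> A}. C j)"
proof -
  have "finite (Pow \<A>)" using assms(1) by simp
  then obtain T where "bij_betw T {0..<card (Pow \<A>)} (Pow \<A>)"
    using ex_bij_betw_nat_finite by blast
  then obtain k where T: "bij_betw T {..<k} (Pow \<A>)"
    by (simp add: atLeast0LessThan)
  define C where "C j = membership_atom M \<A> (T j)" for j
  show thesis
  proof (rule that[of C k])
    show "disjoint_family_on C {..<k}"
      using T unfolding C_def disjoint_family_on_def
      by (intro ballI impI membership_atom_disjoint) (auto simp: bij_betw_def inj_on_def)
    show "C ` {..<k} \<subseteq> sets M"
      using sets_membership_atom[OF assms] by (auto simp: C_def)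
    show "\<forall>A\<in>\<A>. A = (\<Union>j\<in>{j. j < k \<and> C j \<subseteq> A}. C j)"
    proof
      fix A assume A: "A \<in> \<A>"
      then have "A \<subseteq> space M" using assms(2) sets.sets_into_space by blast
      with A have "A = \<Union>{membership_atom M \<A> S | S. S \<subseteq> \<A> \<and> membership_atom M \<A> S \<subseteq> A}"
        by (rule eq_Union_membership_atoms)
      also have "{membership_atom M \<A> S | S. S \<subseteq> \<A> \<and> membership_atom M \<A> S \<subseteq> A}
          = C ` {j. j < k \<and> C j \<subseteq> A}"
        unfolding Pow_iff[symmetric] bij_betw_imp_surj_on[OF T, symmetric] by (auto simp: C_def)
      finally show "A = (\<Union>j\<in>{j. j < k \<and> C j \<subseteq> A}. C j)" .
    qed
  qed
qed

lemma prod_expneg_power_refinement: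
  fixes C :: "nat \<Rightarrow> 'a set" and n :: "'a set \<Rightarrow> nat"
  assumes "finite \<A>" and C: "disjoint_family_on C {..<k}" "C ` {..<k} \<subseteq> sets m"
    and refine: "\<And>A. A \<in> \<A> \<Longrightarrow> A = (\<Union>j\<in>{j. j < k \<and> C j \<subseteq> A}. C j)"
  shows "(\<Prod>A\<in>\<A>. expneg 1 (emeasure m A) ^ n A)
    = (\<Prod>j<k. expneg (\<Sum>A\<in>\<A>. if C j \<subseteq> A then real (n A) else 0) (emeasure m (C j)))"
proof -
  have "expneg 1 (emeasure m A) ^ n A
      = (\<Prod>j<k. expneg (if C j \<subseteq> A then real (n A) else 0) (emeasure m (C j)))"
    if "A \<in> \<A>" for A
  proof -
    let ?J = "{j. j < k \<and> C j \<subseteq> A}"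
    have subset: "?J \<subseteq> {..<k}" by auto
    have "emeasure m A = emeasure m (\<Union>j\<in>?J. C j)" using refine[OF that] by simp
    also have "\<dots> = (\<Sum>j\<in>?J. emeasure m (C j))"
      using C(2) subset by (intro sum_emeasure[symmetric] disjoint_family_on_mono[OF subset C(1)]
          finite_subset[OF subset]) auto
    finally have "expneg 1 (emeasure m A) ^ n A = (\<Prod>j\<in>?J. expneg (real (n A)) (emeasure m (C j)))"
      by (simp add: expneg_sum_right expneg_power prod_power_distrib)
    also have "\<dots> = (\<Prod>j<k. expneg (if C j \<subseteq> A then real (n A) else 0) (emeasure m (C j)))"
      by (rule prod.mono_neutral_cong_left) auto
    finally show ?thesis .
  qed
  then have "(\<Prod>A\<in>\<A>. expneg 1 (emeasure m A) ^ n A)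
      = (\<Prod>A\<in>\<A>. \<Prod>j<k. expneg (if C j \<subseteq> A then real (n A) else 0) (emeasure m (C j)))"
    by (rule prod.cong[OF refl])
  also have "\<dots> = (\<Prod>j<k. \<Prod>A\<in>\<A>. expneg (if C j \<subseteq> A then real (n A) else 0) (emeasure m (C j)))"
    by (rule prod.swap)
  also have "\<dots> = (\<Prod>j<k. expneg (\<Sum>A\<in>\<A>. if C j \<subseteq> A then real (n A) else 0) (emeasure m (C j)))"
    using assms(1) by (simp add: expneg_sum_left)
  finally show ?thesis .
qed

lemma prod_evaluations_refinement:
  fixes J :: "(nat \<times> ('x::polish_space) set) set" and n :: "nat \<times> 'x set \<Rightarrow> nat"
  assumes J: "finite J" "J \<subseteq> {1..d} \<times> sets borel"
  obtains k :: nat and C :: "nat \<Rightarrow> 'x set" and lam :: "nat \<Rightarrow> nat \<Rightarrow> real"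
  where "disjoint_family_on C {..<k}" "C ` {..<k} \<subseteq> sets borel" "\<forall>i j. 0 \<le> lam i j"
    "\<forall>m\<in>space (rm_space d). (\<Prod>v\<in>J. expneg 1 (emeasure (m (fst v)) (snd v)) ^ n v)
      = (\<Prod>i\<in>{1..d}. \<Prod>j<k. expneg (lam i j) (emeasure (m i) (C j)))"
proof -
  have "finite (snd ` J)" "snd ` J \<subseteq> sets borel" using J by auto
  then obtain C :: "nat \<Rightarrow> 'x set" and k
    where C: "disjoint_family_on C {..<k}" "C ` {..<k} \<subseteq> sets borel"
    and refine: "\<forall>A\<in>snd ` J. A = (\<Union>j\<in>{j. j < k \<and> C j \<subseteq> A}. C j)"
    by (rule finite_family_disjoint_refinement) (rule that)
  define lam where "lam i j = (\<Sum>A\<in>J `` {i}. if C j \<subseteq> A then real (n (i, A)) else 0)" for i j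
  show thesis
  proof (rule that[OF C])
    show "\<forall>i j. 0 \<le> lam i j" unfolding lam_def by (intro allI sum_nonneg) auto
    show "\<forall>m\<in>space (rm_space d). (\<Prod>v\<in>J. expneg 1 (emeasure (m (fst v)) (snd v)) ^ n v)
      = (\<Prod>i\<in>{1..d}. \<Prod>j<k. expneg (lam i j) (emeasure (m i) (C j)))"
    proof
      fix m :: "nat \<Rightarrow> 'x measure" assume m: "m \<in> space (rm_space d)"
      have fin: "finite (J `` {i})" for i
        using J(1) by (rule finite_Image)
      have "(\<Prod>v\<in>J. expneg 1 (emeasure (m (fst v)) (snd v)) ^ n v)
          = (\<Prod>(i, A)\<in>Sigma {1..d} (\<lambda>i. J `` {i}). expneg 1 (emeasure (m i) A) ^ n (i, A))"
        using J(2) by (intro prod.cong) auto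
      also have "\<dots> = (\<Prod>i\<in>{1..d}. \<Prod>A\<in>J `` {i}. expneg 1 (emeasure (m i) A) ^ n (i, A))"
        using fin by (intro prod.Sigma[symmetric]) auto
      also have "\<dots> = (\<Prod>i\<in>{1..d}. \<Prod>j<k. expneg (lam i j) (emeasure (m i) (C j)))"
        unfolding lam_def
      proof (intro prod.cong[OF refl] prod_expneg_power_refinement fin C(1))
        fix i assume "i \<in> {1..d}"
        then show "C ` {..<k} \<subseteq> sets (m i)" using m C(2) by (auto simp: space_rm_space bfm_def)
      qed (use refine in force)
      finally show "(\<Prod>v\<in>J. expneg 1 (emeasure (m (fst v)) (snd v)) ^ n v)
        = (\<Prod>i\<in>{1..d}. \<Prod>j<k. expneg (lam i j) (emeasure (m i) (C j)))" .
    qed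
  qed
qed

lemma evaluation_moments_eqI_joint_laplace:
  fixes \<mu>1 :: "'a \<Rightarrow> nat \<Rightarrow> ('x::polish_space) measure" and \<mu>2 :: "'b \<Rightarrow> nat \<Rightarrow> 'x measure"
  assumes \<mu>1: "\<mu>1 \<in> measurable M1 (rm_space d)" and \<mu>2: "\<mu>2 \<in> measurable M2 (rm_space d)"
    and laplace: "\<And>k A lam. disjoint_family_on A {..<k} \<Longrightarrow> A ` {..<k} \<subseteq> sets borel \<Longrightarrow>
      (\<And>i j. 0 \<le> lam i j) \<Longrightarrow> joint_laplace M1 d \<mu>1 k A lam = joint_laplace M2 d \<mu>2 k A lam"
    and J: "finite J" "J \<subseteq> {1..d} \<times> sets borel"
  shows "(\<integral>\<omega>. (\<Prod>v\<in>J. expneg 1 (emeasure (\<mu>1 \<omega> (fst v)) (snd v)) ^ n v) \<partial>M1)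
       = (\<integral>\<omega>. (\<Prod>v\<in>J. expneg 1 (emeasure (\<mu>2 \<omega> (fst v)) (snd v)) ^ n v) \<partial>M2)"
proof -
  obtain k :: nat and C lam
    where C: "disjoint_family_on C {..<k}" "C ` {..<k} \<subseteq> sets borel" "\<forall>i j. 0 \<le> lam i j"
      and refine: "\<forall>m\<in>space (rm_space d). (\<Prod>v\<in>J. expneg 1 (emeasure (m (fst v)) (snd v)) ^ n v)
        = (\<Prod>i\<in>{1..d}. \<Prod>j<k. expneg (lam i j) (emeasure (m i) (C j)))"
    by (rule prod_evaluations_refinement[OF J, where n=n]) (rule that)
  have "(\<integral>\<omega>. (\<Prod>v\<in>J. expneg 1 (emeasure (\<mu>1 \<omega> (fst v)) (snd v)) ^ n v) \<partial>M1)
      = joint_laplace M1 d \<mu>1 k C lam"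
    unfolding joint_laplace_def
    by (intro Bochner_Integration.integral_cong refl bspec[OF refine] measurable_space[OF \<mu>1])
  also have "\<dots> = joint_laplace M2 d \<mu>2 k C lam" using C by (intro laplace) auto
  also have "\<dots> = (\<integral>\<omega>. (\<Prod>v\<in>J. expneg 1 (emeasure (\<mu>2 \<omega> (fst v)) (snd v)) ^ n v) \<partial>M2)"
    unfolding joint_laplace_def
    by (intro Bochner_Integration.integral_cong refl bspec[OF refine, symmetric]
        measurable_space[OF \<mu>2])
  finally show ?thesis .
qed

theorem eq_distI_joint_laplace:
  fixes \<mu>1 :: "'a \<Rightarrow> nat \<Rightarrow> ('x::polish_space) measure" and \<mu>2 :: "'b \<Rightarrow> nat \<Rightarrow> 'x measure"
  assumes M: "finite_measure M1" "finite_measure M2"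
    and \<mu>1: "\<mu>1 \<in> measurable M1 (rm_space d)" and \<mu>2: "\<mu>2 \<in> measurable M2 (rm_space d)"
    and laplace: "\<And>k A lam. disjoint_family_on A {..<k} \<Longrightarrow> A ` {..<k} \<subseteq> sets borel \<Longrightarrow>
      (\<And>i j. 0 \<le> lam i j) \<Longrightarrow> joint_laplace M1 d \<mu>1 k A lam = joint_laplace M2 d \<mu>2 k A lam"
  shows "eq_dist d M1 \<mu>1 M2 \<mu>2"
  unfolding eq_dist_def
proof (rule rm_space_measure_eqI_laplace_evals)
  let ?V = "{1..d} \<times> sets (borel :: 'x measure)"
  let ?P = "Pi\<^sub>M ?V (\<lambda>_. borel :: real measure)"
  let ?X = "\<lambda>v \<omega>. expneg 1 (emeasure (\<mu>1 \<omega> (fst v)) (snd v))"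
  let ?Y = "\<lambda>v \<omega>. expneg 1 (emeasure (\<mu>2 \<omega> (fst v)) (snd v))"
  have evals: "laplace_evals d \<circ> \<mu>1 = (\<lambda>\<omega>. \<lambda>v\<in>?V. ?X v \<omega>)"
    "laplace_evals d \<circ> \<mu>2 = (\<lambda>\<omega>. \<lambda>v\<in>?V. ?Y v \<omega>)"
    by (auto simp: laplace_evals_def fun_eq_iff)
  have "distr M1 ?P (\<lambda>\<omega>. \<lambda>v\<in>?V. ?X v \<omega>) = distr M2 ?P (\<lambda>\<omega>. \<lambda>v\<in>?V. ?Y v \<omega>)"
  proof (rule distr_PiM_eqI_joint_moments[OF M])
    fix v assume "v \<in> ?V"
    then have v: "fst v \<in> {1..d}" "snd v \<in> sets borel" by auto
    note eval = borel_measurable_emeasure_rm_space[OF v]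
    show "?X v \<in> borel_measurable M1"
      by (rule measurable_compose[OF measurable_compose[OF \<mu>1 eval] borel_measurable_expneg])
    show "?Y v \<in> borel_measurable M2"
      by (rule measurable_compose[OF measurable_compose[OF \<mu>2 eval] borel_measurable_expneg])
    show "?X v \<omega> \<in> {0..1}" "?Y v \<omega>' \<in> {0..1}" for \<omega> \<omega>'
      by (rule expneg_unit_interval; simp)+
  next
    fix J n assume "finite J" "J \<subseteq> ?V"
    then show "(\<integral>\<omega>. (\<Prod>v\<in>J. ?X v \<omega> ^ n v) \<partial>M1) = (\<integral>\<omega>. (\<Prod>v\<in>J. ?Y v \<omega> ^ n v) \<partial>M2)"
      by (intro evaluation_moments_eqI_joint_laplace[OF \<mu>1 \<mu>2] laplace)
  qed
  then show "distr (distr M1 (rm_space d) \<mu>1) ?P (laplace_evals d)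
      = distr (distr M2 (rm_space d) \<mu>2) ?P (laplace_evals d)"
    by (simp only: distr_distr[OF measurable_laplace_evals \<mu>1]
        distr_distr[OF measurable_laplace_evals \<mu>2] evals)
qed simp_all

section \<open>Hierarchical vectors\<close>

lemma space_rm1: "space rm1 = bfm"
  unfolding rm1_def by (rule space_measure_of) auto

lemma CRM_joint_laplace:
  fixes A :: "nat \<Rightarrow> ('x::polish_space) set"
  assumes "prob_space M" and CRM: "is_CRM M \<mu> \<rho> P"
    and A: "disjoint_family_on A {..<k}" "A ` {..<k} \<subseteq> sets borel" and a_nonneg: "\<And>j. 0 \<le> a j"
  shows "(\<integral>\<omega>. (\<Prod>j<k. expneg (a j) (emeasure (\<mu> \<omega>) (A j))) \<partial>M)
    = (\<Prod>j<k. exp (- measure P (A j) * laplace_exp \<rho> (a j)))"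
proof -
  interpret prob_space M by fact
  define A' where "A' j = (if j < k then A j else {})" for j
  have A': "disjoint_family A'" "range A' \<subseteq> sets borel" "\<And>j. j < k \<Longrightarrow> A' j = A j"
    using A by (auto simp: A'_def disjoint_family_on_def)
  have "indep_vars (\<lambda>_. borel) (\<lambda>j \<omega>. emeasure (\<mu> \<omega>) (A' j)) UNIV"
    using CRM A' unfolding is_CRM_def by blast
  then have "indep_vars (\<lambda>_. borel) (\<lambda>j \<omega>. emeasure (\<mu> \<omega>) (A' j)) {..<k}"
    by (rule indep_vars_subset) simp
  then have indep: "indep_vars (\<lambda>_. borel) (\<lambda>j \<omega>. expneg (a j) (emeasure (\<mu> \<omega>) (A' j))) {..<k}"
    by (rule indep_vars_compose2[where Y="\<lambda>j. expneg (a j)"]) measurable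
  have "(\<integral>\<omega>. (\<Prod>j<k. expneg (a j) (emeasure (\<mu> \<omega>) (A' j))) \<partial>M)
      = (\<Prod>j<k. \<integral>\<omega>. expneg (a j) (emeasure (\<mu> \<omega>) (A' j)) \<partial>M)"
  proof (rule indep_vars_lebesgue_integral[OF _ indep])
    fix j assume "j \<in> {..<k}"
    then have "(\<lambda>\<omega>. expneg (a j) (emeasure (\<mu> \<omega>) (A' j))) \<in> borel_measurable M"
      using indep by (simp add: indep_vars_def)
    then show "integrable M (\<lambda>\<omega>. expneg (a j) (emeasure (\<mu> \<omega>) (A' j)))"
      using expneg_unit_interval[OF a_nonneg] by (intro integrable_const_bound[where B=1]) auto
  qed simp
  also have "\<dots> = (\<Prod>j<k. exp (- measure P (A' j) * laplace_exp \<rho> (a j)))"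
    using CRM A'(2) a_nonneg by (intro prod.cong refl) (auto simp: is_CRM_def)
  finally show ?thesis by (simp add: A'(3))
qed

lemma cond_CRMs_joint_laplace:
  fixes A :: "nat \<Rightarrow> ('x::polish_space) set"
  assumes cond: "cond_CRMs M d \<mu> \<mu>0 \<rho>" and \<mu>0: "\<mu>0 \<in> measurable M rm1"
    and levy: "levy_measure \<rho>"
    and A: "disjoint_family_on A {..<k}" "A ` {..<k} \<subseteq> sets borel"
    and lam_nonneg: "\<And>i j. 0 \<le> lam i j"
  shows "joint_laplace M d \<mu> k A lam
    = (\<integral>\<omega>. (\<Prod>j<k. expneg (\<Sum>i\<in>{1..d}. laplace_exp \<rho> (lam i j)) (emeasure (\<mu>0 \<omega>) (A j))) \<partial>M)"
proof -
  have bfm: "indicator bfm (\<mu>0 \<omega>) = (1::real)" if "\<omega> \<in> space M" for \<omega>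
    using measurable_space[OF \<mu>0 that] by (simp add: space_rm1)
  have "bfm \<in> sets rm1" using sets.top[of rm1] by (simp add: space_rm1)
  then have "(\<integral>\<omega>. indicator bfm (\<mu>0 \<omega>) *
        (\<Prod>i\<in>{1..d}. \<Prod>j<k. expneg (lam i j) (emeasure (\<mu> \<omega> i) (A j))) \<partial>M)
      = (\<integral>\<omega>. indicator bfm (\<mu>0 \<omega>) *
        (\<Prod>i\<in>{1..d}. \<Prod>j<k. expneg (laplace_exp \<rho> (lam i j)) (emeasure (\<mu>0 \<omega>) (A j))) \<partial>M)"
    using cond A lam_nonneg unfolding cond_CRMs_def by blast
  then have "joint_laplace M d \<mu> k A lam
      = (\<integral>\<omega>. (\<Prod>i\<in>{1..d}. \<Prod>j<k. expneg (laplace_exp \<rho> (lam i j)) (emeasure (\<mu>0 \<omega>) (A j))) \<partial>M)"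
    by (simp add: joint_laplace_def bfm cong: Bochner_Integration.integral_cong)
  also have "\<dots>
      = (\<integral>\<omega>. (\<Prod>j<k. \<Prod>i\<in>{1..d}. expneg (laplace_exp \<rho> (lam i j)) (emeasure (\<mu>0 \<omega>) (A j))) \<partial>M)"
    by (subst prod.swap) (rule refl)
  finally show ?thesis
    by (simp add: expneg_sum_left laplace_exp_nonneg levy lam_nonneg)
qed

definition hCRV_laplace_exp :: "nat \<Rightarrow> real measure \<Rightarrow> real measure \<Rightarrow> (nat \<Rightarrow> real) \<Rightarrow> real" where
  "hCRV_laplace_exp d \<rho> \<rho>0 lam = laplace_exp \<rho>0 (\<Sum>i\<in>{1..d}. laplace_exp \<rho> (lam i))"

lemma hCRV_joint_laplace:
  fixes \<mu> :: "'a \<Rightarrow> nat \<Rightarrow> ('x::polish_space) measure"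
  assumes hCRV: "is_hCRV M d \<mu> \<rho> \<rho>0 P0" and levy: "levy_measure \<rho>"
    and A: "disjoint_family_on A {..<k}" "A ` {..<k} \<subseteq> sets borel"
    and lam_nonneg: "\<And>i j. 0 \<le> lam i j"
  shows "joint_laplace M d \<mu> k A lam
    = (\<Prod>j<k. exp (- measure P0 (A j) * hCRV_laplace_exp d \<rho> \<rho>0 (\<lambda>i. lam i j)))"
proof -
  obtain \<mu>0 where M: "prob_space M" and \<mu>0: "is_CRM M \<mu>0 \<rho>0 P0"
    and cond: "cond_CRMs M d \<mu> \<mu>0 \<rho>"
    using hCRV by (auto simp: is_hCRV_def)
  have "0 \<le> (\<Sum>i\<in>{1..d}. laplace_exp \<rho> (lam i j))" for j
    by (intro sum_nonneg laplace_exp_nonneg levy lam_nonneg)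
  then show ?thesis
    using cond_CRMs_joint_laplace[OF cond _ levy A lam_nonneg] CRM_joint_laplace[OF M \<mu>0 A] \<mu>0
    by (simp add: hCRV_laplace_exp_def is_CRM_def)
qed

theorem hCRV_eq_dist_iff_laplace_exp:
  fixes \<mu>1 :: "'a \<Rightarrow> nat \<Rightarrow> ('x::polish_space) measure" and \<mu>2 :: "'b \<Rightarrow> nat \<Rightarrow> 'x measure"
  assumes hCRV1: "is_hCRV M1 d \<mu>1 \<rho>1 \<rho>01 P01" and hCRV2: "is_hCRV M2 d \<mu>2 \<rho>2 \<rho>02 P02"
    and levy: "levy_measure \<rho>1" "levy_measure \<rho>2"
  shows "eq_dist d M1 \<mu>1 M2 \<mu>2 \<longleftrightarrow> (\<forall>A\<in>sets borel. \<forall>lam. (\<forall>i. 0 \<le> lam i) \<longrightarrow>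
    measure P01 A * hCRV_laplace_exp d \<rho>1 \<rho>01 lam = measure P02 A * hCRV_laplace_exp d \<rho>2 \<rho>02 lam)"
proof -
  have \<mu>: "\<mu>1 \<in> measurable M1 (rm_space d)" "\<mu>2 \<in> measurable M2 (rm_space d)"
    using hCRV1 hCRV2 by (simp_all add: is_hCRV_def)
  show ?thesis
  proof (intro iffI ballI allI impI)
    fix A :: "'x set" and lam :: "nat \<Rightarrow> real"
    assume eq: "eq_dist d M1 \<mu>1 M2 \<mu>2" and A: "A \<in> sets borel" and lam: "\<forall>i. 0 \<le> lam i"
    have "joint_laplace M1 d \<mu>1 (Suc 0) (\<lambda>_. A) (\<lambda>i _. lam i)
        = joint_laplace M2 d \<mu>2 (Suc 0) (\<lambda>_. A) (\<lambda>i _. lam i)"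
      using A by (intro joint_laplace_eq_if_eq_dist[OF \<mu> eq]) auto
    then show "measure P01 A * hCRV_laplace_exp d \<rho>1 \<rho>01 lam
        = measure P02 A * hCRV_laplace_exp d \<rho>2 \<rho>02 lam"
      using A lam hCRV_joint_laplace[OF hCRV1 levy(1)] hCRV_joint_laplace[OF hCRV2 levy(2)]
      by (simp add: disjoint_family_on_def image_subset_iff)
  next
    assume exp_eq: "\<forall>A\<in>sets borel. \<forall>lam. (\<forall>i. 0 \<le> lam i) \<longrightarrow>
      measure P01 A * hCRV_laplace_exp d \<rho>1 \<rho>01 lam = measure P02 A * hCRV_laplace_exp d \<rho>2 \<rho>02 lam"
    show "eq_dist d M1 \<mu>1 M2 \<mu>2"
    proof (rule eq_distI_joint_laplace[OF _ _ \<mu>])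
      fix k and A :: "nat \<Rightarrow> 'x set" and lam :: "nat \<Rightarrow> nat \<Rightarrow> real"
      assume A: "disjoint_family_on A {..<k}" "A ` {..<k} \<subseteq> sets borel"
        and lam: "\<And>i j. 0 \<le> lam i j"
      show "joint_laplace M1 d \<mu>1 k A lam = joint_laplace M2 d \<mu>2 k A lam"
        unfolding hCRV_joint_laplace[OF hCRV1 levy(1) A lam]
          hCRV_joint_laplace[OF hCRV2 levy(2) A lam]
        using exp_eq A(2) lam by (intro prod.cong refl) (simp add: image_subset_iff)
    qed (use hCRV1 hCRV2 in \<open>auto simp: is_hCRV_def prob_space.finite_measure\<close>)
  qed
qed

section \<open>Identification of the parameters\<close>

definition pair_laplace_exp :: "real measure \<Rightarrow> real measure \<Rightarrow> real \<Rightarrow> real \<Rightarrow> real" where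
  "pair_laplace_exp \<rho> \<rho>0 a b = laplace_exp \<rho>0 (laplace_exp \<rho> a + laplace_exp \<rho> b)"

lemma hCRV_laplace_exp_two_rates:
  assumes "2 \<le> d"
  shows "hCRV_laplace_exp d \<rho> \<rho>0 ((\<lambda>_. 0)(1 := a, 2 := b)) = pair_laplace_exp \<rho> \<rho>0 a b"
proof -
  have "(\<Sum>i\<in>{1..d}. laplace_exp \<rho> (((\<lambda>_. 0)(1 := a, 2 := b)) i))
      = (\<Sum>i\<in>{1, 2::nat}. laplace_exp \<rho> (((\<lambda>_. 0)(1 := a, 2 := b)) i))"
    using assms by (intro sum.mono_neutral_right) auto
  then show ?thesis by (simp add: hCRV_laplace_exp_def pair_laplace_exp_def)
qed

lemma hCRV_laplace_exp_scale_divide: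
  assumes "levy_measure \<rho>" "levy_measure \<rho>0" "0 < c"
  shows "hCRV_laplace_exp d (scale_measure (ennreal c) \<rho>) (distr \<rho>0 borel (\<lambda>s. s / c)) lam
    = hCRV_laplace_exp d \<rho> \<rho>0 lam"
  using assms by (simp add: hCRV_laplace_exp_def sets_levy_measure laplace_exp_scale
      laplace_exp_distr_divide sum_distrib_left[symmetric])

lemma pair_laplace_exp_has_real_derivative:
  assumes levy: "levy_measure \<rho>" "levy_measure \<rho>0" and "\<rho> \<noteq> null_measure borel"
    and "0 < a" "0 < b"
  shows "((\<lambda>x. pair_laplace_exp \<rho> \<rho>0 x b) has_real_derivative
    laplace_exp_deriv \<rho>0 (laplace_exp \<rho> a + laplace_exp \<rho> b) * laplace_exp_deriv \<rho> a) (at a)"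
proof -
  have "0 < laplace_exp \<rho> a + laplace_exp \<rho> b"
    using assms by (intro add_pos_pos laplace_exp_pos)
  moreover have "((\<lambda>x. laplace_exp \<rho> x + laplace_exp \<rho> b) has_real_derivative
      laplace_exp_deriv \<rho> a) (at a)"
    using laplace_exp_has_real_derivative[OF levy(1) \<open>0 < a\<close>] by (auto intro: derivative_eq_intros)
  ultimately show ?thesis
    unfolding pair_laplace_exp_def
    by (rule DERIV_chain2[OF laplace_exp_has_real_derivative[OF levy(2)]])
qed

lemma pair_laplace_exp_partial_derivatives_eq:
  assumes levy: "levy_measure \<rho>1" "levy_measure \<rho>01" "levy_measure \<rho>2" "levy_measure \<rho>02"
    and nontriv: "\<rho>1 \<noteq> null_measure borel" "\<rho>2 \<noteq> null_measure borel"
    and eq: "\<And>a b. 0 < a \<Longrightarrow> 0 < b \<Longrightarrow> pair_laplace_exp \<rho>1 \<rho>01 a b = pair_laplace_exp \<rho>2 \<rho>02 a b"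
    and ab_pos: "0 < a" "0 < b"
  shows "laplace_exp_deriv \<rho>01 (laplace_exp \<rho>1 a + laplace_exp \<rho>1 b) * laplace_exp_deriv \<rho>1 a
    = laplace_exp_deriv \<rho>02 (laplace_exp \<rho>2 a + laplace_exp \<rho>2 b) * laplace_exp_deriv \<rho>2 a"
    (is "?D1 = ?D2")
proof (rule DERIV_unique)
  show "((\<lambda>x. pair_laplace_exp \<rho>2 \<rho>02 x b) has_real_derivative ?D2) (at a)"
    using levy nontriv ab_pos by (intro pair_laplace_exp_has_real_derivative)
  show "((\<lambda>x. pair_laplace_exp \<rho>2 \<rho>02 x b) has_real_derivative ?D1) (at a)"
    using pair_laplace_exp_has_real_derivative[OF levy(1,2) nontriv(1) ab_pos] eq ab_pos
    by (elim has_field_derivative_transform_within_open[where S="{0<..}"]) auto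
qed

lemma laplace_exp_deriv_cross_mult:
  assumes levy: "levy_measure \<rho>1" "levy_measure \<rho>01" "levy_measure \<rho>2" "levy_measure \<rho>02"
    and nontriv: "\<rho>1 \<noteq> null_measure borel" "\<rho>01 \<noteq> null_measure borel"
                 "\<rho>2 \<noteq> null_measure borel" "\<rho>02 \<noteq> null_measure borel"
    and eq: "\<And>a b. 0 < a \<Longrightarrow> 0 < b \<Longrightarrow> pair_laplace_exp \<rho>1 \<rho>01 a b = pair_laplace_exp \<rho>2 \<rho>02 a b"
    and ab_pos: "0 < a" "0 < b"
  shows "laplace_exp_deriv \<rho>2 a * laplace_exp_deriv \<rho>1 b
    = laplace_exp_deriv \<rho>2 b * laplace_exp_deriv \<rho>1 a"
proof -
  let ?outer1 = "laplace_exp_deriv \<rho>01 (laplace_exp \<rho>1 a + laplace_exp \<rho>1 b)"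
  let ?outer2 = "laplace_exp_deriv \<rho>02 (laplace_exp \<rho>2 a + laplace_exp \<rho>2 b)"
  note partial = pair_laplace_exp_partial_derivatives_eq[OF levy nontriv(1,3) eq]
  have partial_a: "?outer2 * laplace_exp_deriv \<rho>2 a = ?outer1 * laplace_exp_deriv \<rho>1 a"
    using partial[of a b] ab_pos by simp
  have partial_b: "?outer1 * laplace_exp_deriv \<rho>1 b = ?outer2 * laplace_exp_deriv \<rho>2 b"
    using partial[of b a] ab_pos by (simp add: add.commute)
  have "?outer2 * ?outer1 * (laplace_exp_deriv \<rho>2 a * laplace_exp_deriv \<rho>1 b)
      = (?outer2 * laplace_exp_deriv \<rho>2 a) * (?outer1 * laplace_exp_deriv \<rho>1 b)" by simp
  also have "\<dots> = ?outer2 * ?outer1 * (laplace_exp_deriv \<rho>2 b * laplace_exp_deriv \<rho>1 a)"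
    unfolding partial_a partial_b by simp
  finally have "?outer2 * ?outer1 * (laplace_exp_deriv \<rho>2 a * laplace_exp_deriv \<rho>1 b)
      = ?outer2 * ?outer1 * (laplace_exp_deriv \<rho>2 b * laplace_exp_deriv \<rho>1 a)" .
  moreover have "0 < ?outer1" "0 < ?outer2"
    using levy nontriv ab_pos by (simp_all add: laplace_exp_deriv_pos laplace_exp_pos add_pos_pos)
  ultimately show ?thesis by simp
qed

lemma laplace_exp_eq_mult_if_deriv_eq_mult:
  assumes levy: "levy_measure \<rho>1" "levy_measure \<rho>2"
    and deriv: "\<And>x. 0 < x \<Longrightarrow> laplace_exp_deriv \<rho>2 x = c * laplace_exp_deriv \<rho>1 x"
    and "0 \<le> t"
  shows "laplace_exp \<rho>2 t = c * laplace_exp \<rho>1 t"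
proof (cases "t = 0")
  case False
  let ?g = "\<lambda>x. laplace_exp \<rho>2 x - c * laplace_exp \<rho>1 x"
  have "?g t = ?g 0"
  proof (rule DERIV_isconst_end[where f="?g"])
    show "continuous_on {0..t} ?g"
      by (intro continuous_intros continuous_on_subset[OF laplace_exp_continuous_on] levy) auto
    show "(?g has_real_derivative 0) (at x)" if "0 < x" "x < t" for x
      using laplace_exp_has_real_derivative[OF levy(1) that(1)]
        laplace_exp_has_real_derivative[OF levy(2) that(1)]
      by (auto intro!: derivative_eq_intros simp: deriv[OF that(1)])
  qed (use False \<open>0 \<le> t\<close> in simp)
  then show ?thesis by simp
qed simp

lemma laplace_exp_attains:
  assumes "levy_measure \<rho>" "0 \<le> x" "x \<le> laplace_exp \<rho> t" "0 \<le> t"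
  obtains a where "0 \<le> a" "laplace_exp \<rho> a = x"
  using IVT'[of "laplace_exp \<rho>" 0 x t] assms
    continuous_on_subset[OF laplace_exp_continuous_on, of \<rho> "{0..t}"] by auto

theorem levy_measures_eq_up_to_scaling:
  assumes levy: "levy_measure \<rho>1" "levy_measure \<rho>01" "levy_measure \<rho>2" "levy_measure \<rho>02"
    and nontriv: "\<rho>1 \<noteq> null_measure borel" "\<rho>01 \<noteq> null_measure borel"
                 "\<rho>2 \<noteq> null_measure borel" "\<rho>02 \<noteq> null_measure borel"
    and eq: "\<And>a b. 0 \<le> a \<Longrightarrow> 0 \<le> b \<Longrightarrow> pair_laplace_exp \<rho>1 \<rho>01 a b = pair_laplace_exp \<rho>2 \<rho>02 a b"
  shows "\<exists>c>0. \<rho>02 = distr \<rho>01 borel (\<lambda>s. s / c) \<and> \<rho>2 = scale_measure (ennreal c) \<rho>1"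
proof -
  define c where "c = laplace_exp_deriv \<rho>2 1 / laplace_exp_deriv \<rho>1 1"
  have deriv_pos: "0 < laplace_exp_deriv \<rho>1 1" "0 < laplace_exp_deriv \<rho>2 1"
    using levy nontriv by (simp_all add: laplace_exp_deriv_pos)
  then have c_pos: "0 < c" by (simp add: c_def)
  have "laplace_exp_deriv \<rho>2 x = c * laplace_exp_deriv \<rho>1 x" if "0 < x" for x
    using laplace_exp_deriv_cross_mult[OF levy nontriv eq that, of 1] deriv_pos
    by (simp add: c_def field_simps)
  then have inner: "laplace_exp \<rho>2 a = c * laplace_exp \<rho>1 a" if "0 \<le> a" for a
    using levy(1,3) that by (intro laplace_exp_eq_mult_if_deriv_eq_mult)
  have "\<rho>2 = scale_measure (ennreal c) \<rho>1"
    using inner c_pos levy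
    by (intro laplace_exp_inject[where r=1] levy_measure_scale)
       (auto simp: laplace_exp_scale sets_levy_measure)
  moreover have "\<rho>02 = distr \<rho>01 borel (\<lambda>s. s / c)"
  proof (rule laplace_exp_inject)
    show "0 < laplace_exp \<rho>2 1" using levy(3) nontriv(3) by (simp add: laplace_exp_pos)
    fix x assume "0 < x" "x < laplace_exp \<rho>2 1"
    then obtain a where a: "0 \<le> a" "laplace_exp \<rho>2 a = x"
      using laplace_exp_attains[OF levy(3), of x 1] by auto
    have "laplace_exp \<rho>02 x = laplace_exp \<rho>01 (laplace_exp \<rho>1 a)"
      using eq[of a 0] a by (simp add: pair_laplace_exp_def)
    also have "laplace_exp \<rho>1 a = x / c"
      using inner[OF a(1)] a(2) c_pos by (simp add: field_simps)
    finally show "laplace_exp \<rho>02 x = laplace_exp (distr \<rho>01 borel (\<lambda>s. s / c)) x"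
      by (simp add: laplace_exp_distr_divide sets_levy_measure levy)
  qed (use levy c_pos in \<open>simp_all add: levy_measure_distr_divide\<close>)
  ultimately show ?thesis using c_pos by blast
qed

lemma prob_spaces_eqI_proportional:
  assumes "prob_space P" "prob_space Q" and sets: "sets P = sets Q"
    and proportional: "\<And>A. A \<in> sets P \<Longrightarrow> measure P A * x = measure Q A * y" and "x \<noteq> 0"
  shows "P = Q"
proof (rule measure_eqI[OF sets])
  interpret P: prob_space P by fact
  interpret Q: prob_space Q by fact
  have "x = y"
    using proportional[OF sets.top] P.prob_space Q.prob_space sets_eq_imp_space_eq[OF sets]
    by simp
  then show "emeasure P A = emeasure Q A" if "A \<in> sets P" for A
    using proportional[OF that] \<open>x \<noteq> 0\<close>
    by (simp add: P.emeasure_eq_measure Q.emeasure_eq_measure)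
qed

theorem hCRV_eq_dist_iff:
  fixes \<mu>1 :: "'a \<Rightarrow> nat \<Rightarrow> ('x::polish_space) measure" and \<mu>2 :: "'b \<Rightarrow> nat \<Rightarrow> 'x measure"
  assumes d: "2 \<le> d"
    and levy: "levy_measure \<rho>1" "levy_measure \<rho>01" "levy_measure \<rho>2" "levy_measure \<rho>02"
    and nontriv: "\<rho>1 \<noteq> null_measure borel" "\<rho>01 \<noteq> null_measure borel"
                 "\<rho>2 \<noteq> null_measure borel" "\<rho>02 \<noteq> null_measure borel"
    and P0: "prob_space P01" "sets P01 = sets borel" "prob_space P02" "sets P02 = sets borel"
    and hCRV: "is_hCRV M1 d \<mu>1 \<rho>1 \<rho>01 P01" "is_hCRV M2 d \<mu>2 \<rho>2 \<rho>02 P02"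
  shows "eq_dist d M1 \<mu>1 M2 \<mu>2 \<longleftrightarrow>
    (\<exists>c>0. \<rho>02 = distr \<rho>01 borel (\<lambda>s. s / c) \<and> \<rho>2 = scale_measure (ennreal c) \<rho>1 \<and> P01 = P02)"
proof
  assume eq: "eq_dist d M1 \<mu>1 M2 \<mu>2"
  have scaled: "measure P01 A * pair_laplace_exp \<rho>1 \<rho>01 a b
      = measure P02 A * pair_laplace_exp \<rho>2 \<rho>02 a b"
    if "A \<in> sets borel" "0 \<le> a" "0 \<le> b" for A a b
    using eq that
    unfolding hCRV_eq_dist_iff_laplace_exp[OF hCRV levy(1,3)]
      hCRV_laplace_exp_two_rates[OF d, symmetric] by simp
  have "0 < pair_laplace_exp \<rho>1 \<rho>01 1 1"
    using levy nontriv by (simp add: pair_laplace_exp_def laplace_exp_pos)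
  then have base_eq: "P01 = P02"
    using P0 scaled[of _ 1 1] by (intro prob_spaces_eqI_proportional) auto
  have "pair_laplace_exp \<rho>1 \<rho>01 a b = pair_laplace_exp \<rho>2 \<rho>02 a b" if "0 \<le> a" "0 \<le> b" for a b
    using scaled[of UNIV a b] that base_eq prob_space.prob_space[OF P0(3)]
      sets_eq_imp_space_eq[OF P0(4)] by simp
  then show "\<exists>c>0. \<rho>02 = distr \<rho>01 borel (\<lambda>s. s / c) \<and>
      \<rho>2 = scale_measure (ennreal c) \<rho>1 \<and> P01 = P02"
    using levy_measures_eq_up_to_scaling[OF levy nontriv] base_eq by simp
next
  assume "\<exists>c>0. \<rho>02 = distr \<rho>01 borel (\<lambda>s. s / c) \<and> \<rho>2 = scale_measure (ennreal c) \<rho>1 \<and> P01 = P02"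
  then show "eq_dist d M1 \<mu>1 M2 \<mu>2"
    unfolding hCRV_eq_dist_iff_laplace_exp[OF hCRV levy(1,3)]
    using levy(1,2) by (auto simp: hCRV_laplace_exp_scale_divide)
qed

section \<open>Levy densities\<close>

lemma distr_density_lborel_divide:
  fixes f :: "real \<Rightarrow> real"
  assumes [measurable]: "f \<in> borel_measurable borel" and c_pos: "0 < c"
  shows "distr (density lborel (\<lambda>s. ennreal (f s))) borel (\<lambda>s. s / c)
    = density lborel (\<lambda>s. ennreal (c * f (c * s)))"
proof -
  have divide: "(\<lambda>s. s / c) = (*) (1 / c)" by (simp add: fun_eq_iff)
  have "distr (density lborel (\<lambda>s. ennreal (f s))) borel (\<lambda>s. s / c)
      = density (distr lborel borel ((*) (1 / c))) (\<lambda>s. ennreal (f (c * s)))"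
    using c_pos unfolding divide by (subst density_distr) simp_all
  also have "distr lborel borel ((*) (1 / c)) = density lborel (\<lambda>_. ennreal c)"
    using c_pos lborel_distr_mult[of "1 / c"] by simp
  also have "density (density lborel (\<lambda>_. ennreal c)) (\<lambda>s. ennreal (f (c * s)))
      = density lborel (\<lambda>s. ennreal (c * f (c * s)))"
    using c_pos by (subst density_density_eq) (auto simp: ennreal_mult')
  finally show ?thesis .
qed

lemma scale_density:
  fixes f :: "'a \<Rightarrow> real"
  assumes [measurable]: "f \<in> borel_measurable M" and "0 \<le> c"
  shows "scale_measure (ennreal c) (density M (\<lambda>s. ennreal (f s)))
    = density M (\<lambda>s. ennreal (c * f s))"
  using assms(2)
  by (simp add: scale_measure_eq_density density_density_eq ennreal_mult' mult.commute)

lemma levy_density_eq_iff: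
  fixes f g :: "real \<Rightarrow> real"
  assumes [measurable]: "f \<in> borel_measurable borel" "g \<in> borel_measurable borel"
    and nonneg: "\<And>s. 0 \<le> f s" "\<And>s. 0 \<le> g s"
    and levy: "levy_measure (density lborel (\<lambda>s. ennreal (f s)))"
      "levy_measure (density lborel (\<lambda>s. ennreal (g s)))"
  shows "density lborel (\<lambda>s. ennreal (f s)) = density lborel (\<lambda>s. ennreal (g s))
    \<longleftrightarrow> (AE s in lborel. 0 < s \<longrightarrow> f s = g s)"
proof -
  have "AE s in lborel. 0 < f s \<longrightarrow> 0 < s" "AE s in lborel. 0 < g s \<longrightarrow> 0 < s"
    using levy_measure_AE_pos[OF levy(1)] levy_measure_AE_pos[OF levy(2)]
    by (simp_all add: AE_density)
  then have "AE s in lborel. f s = g s \<longleftrightarrow> (0 < s \<longrightarrow> f s = g s)"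
  proof eventually_elim
    case (elim s)
    then show ?case using nonneg[of s] by (metis order_le_less)
  qed
  then have "(AE s in lborel. f s = g s) \<longleftrightarrow> (AE s in lborel. 0 < s \<longrightarrow> f s = g s)"
    by (rule eventually_subst)
  then show ?thesis
    using nonneg by (subst sigma_finite_measure.density_unique_iff[OF sigma_finite_lborel]) auto
qed

lemma levy_densities_rescaled_iff:
  fixes f1 f01 f2 f02 :: "real \<Rightarrow> real"
  assumes f: "\<forall>f\<in>{f1, f01, f2, f02}. f \<in> borel_measurable borel \<and> (\<forall>s. 0 \<le> f s)"
    and \<rho>: "\<rho>1 = density lborel (\<lambda>s. ennreal (f1 s))" "\<rho>01 = density lborel (\<lambda>s. ennreal (f01 s))"
      "\<rho>2 = density lborel (\<lambda>s. ennreal (f2 s))" "\<rho>02 = density lborel (\<lambda>s. ennreal (f02 s))"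
    and levy: "levy_measure \<rho>1" "levy_measure \<rho>01" "levy_measure \<rho>2" "levy_measure \<rho>02"
    and c_pos: "0 < c"
  shows "\<rho>02 = distr \<rho>01 borel (\<lambda>s. s / c) \<and> \<rho>2 = scale_measure (ennreal c) \<rho>1 \<longleftrightarrow>
    (AE s in lborel. 0 < s \<longrightarrow> f02 s = c * f01 (c * s) \<and> f2 s = c * f1 s)"
proof -
  have [measurable]: "f1 \<in> borel_measurable borel" "f01 \<in> borel_measurable borel"
    "f2 \<in> borel_measurable borel" "f02 \<in> borel_measurable borel" using f by auto
  have nonneg: "0 \<le> f1 s" "0 \<le> f01 s" "0 \<le> f2 s" "0 \<le> f02 s" for s using f by auto
  have distr: "distr \<rho>01 borel (\<lambda>s. s / c) = density lborel (\<lambda>s. ennreal (c * f01 (c * s)))"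
    unfolding \<rho> using c_pos by (intro distr_density_lborel_divide) measurable
  have scale: "scale_measure (ennreal c) \<rho>1 = density lborel (\<lambda>s. ennreal (c * f1 s))"
    unfolding \<rho> using c_pos by (intro scale_density) auto
  have "\<rho>02 = distr \<rho>01 borel (\<lambda>s. s / c) \<longleftrightarrow> (AE s in lborel. 0 < s \<longrightarrow> f02 s = c * f01 (c * s))"
    using levy_measure_distr_divide[OF levy(2) c_pos] levy(4) c_pos nonneg unfolding distr \<rho>(4)
    by (intro levy_density_eq_iff) auto
  moreover have "\<rho>2 = scale_measure (ennreal c) \<rho>1 \<longleftrightarrow> (AE s in lborel. 0 < s \<longrightarrow> f2 s = c * f1 s)"
    using levy_measure_scale[OF levy(1), of c] levy(3) c_pos nonneg unfolding scale \<rho>(3)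
    by (intro levy_density_eq_iff) auto
  ultimately show ?thesis
    by (simp add: imp_conjR AE_conj_iff)
qed

theorem mainTheorem3:
  fixes d :: nat
    and M1 :: "'a measure" and \<mu>1 :: "'a \<Rightarrow> nat \<Rightarrow> ('x::polish_space) measure"
    and M2 :: "'b measure" and \<mu>2 :: "'b \<Rightarrow> nat \<Rightarrow> 'x measure"
    and \<rho>1 \<rho>01 \<rho>2 \<rho>02 :: "real measure" and P01 P02 :: "'x measure"
  assumes d: "2 \<le> d"
    and levy: "levy_measure \<rho>1" "levy_measure \<rho>01" "levy_measure \<rho>2" "levy_measure \<rho>02"
    and nontriv: "\<rho>1 \<noteq> null_measure borel" "\<rho>01 \<noteq> null_measure borel"
                 "\<rho>2 \<noteq> null_measure borel" "\<rho>02 \<noteq> null_measure borel"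
    and P0: "atomless_prob P01" "atomless_prob P02"
    and h1: "is_hCRV M1 d \<mu>1 \<rho>1 \<rho>01 P01"
    and h2: "is_hCRV M2 d \<mu>2 \<rho>2 \<rho>02 P02"
  shows "(eq_dist d M1 \<mu>1 M2 \<mu>2 \<longleftrightarrow>
            (\<exists>c>0. \<rho>02 = distr \<rho>01 borel (\<lambda>s. s / c) \<and>
                   \<rho>2 = scale_measure (ennreal c) \<rho>1 \<and> P01 = P02))
       \<and> (\<forall>f1 f01 f2 f02 :: real \<Rightarrow> real.
            (\<forall>f\<in>{f1, f01, f2, f02}. f \<in> borel_measurable borel \<and> (\<forall>s. 0 \<le> f s)) \<and>
            \<rho>1 = density lborel (\<lambda>s. ennreal (f1 s)) \<and> \<rho>01 = density lborel (\<lambda>s. ennreal (f01 s)) \<and>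
            \<rho>2 = density lborel (\<lambda>s. ennreal (f2 s)) \<and> \<rho>02 = density lborel (\<lambda>s. ennreal (f02 s))
          \<longrightarrow> (eq_dist d M1 \<mu>1 M2 \<mu>2 \<longleftrightarrow>
               (\<exists>c>0. (AE s in lborel. 0 < s \<longrightarrow> f02 s = c * f01 (c * s) \<and> f2 s = c * f1 s)
                      \<and> P01 = P02)))"
proof (intro conjI allI impI)
  show iff: "eq_dist d M1 \<mu>1 M2 \<mu>2 \<longleftrightarrow>
      (\<exists>c>0. \<rho>02 = distr \<rho>01 borel (\<lambda>s. s / c) \<and> \<rho>2 = scale_measure (ennreal c) \<rho>1 \<and> P01 = P02)"
    using P0 by (intro hCRV_eq_dist_iff[OF d levy nontriv _ _ _ _ h1 h2])
      (auto simp: atomless_prob_def)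
  fix f1 f01 f2 f02 :: "real \<Rightarrow> real"
  assume "(\<forall>f\<in>{f1, f01, f2, f02}. f \<in> borel_measurable borel \<and> (\<forall>s. 0 \<le> f s)) \<and>
    \<rho>1 = density lborel (\<lambda>s. ennreal (f1 s)) \<and> \<rho>01 = density lborel (\<lambda>s. ennreal (f01 s)) \<and>
    \<rho>2 = density lborel (\<lambda>s. ennreal (f2 s)) \<and> \<rho>02 = density lborel (\<lambda>s. ennreal (f02 s))"
  then have "\<rho>02 = distr \<rho>01 borel (\<lambda>s. s / c) \<and> \<rho>2 = scale_measure (ennreal c) \<rho>1 \<longleftrightarrow>
      (AE s in lborel. 0 < s \<longrightarrow> f02 s = c * f01 (c * s) \<and> f2 s = c * f1 s)" if "0 < c" for c
    using levy that by (intro levy_densities_rescaled_iff) blast+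
  then show "eq_dist d M1 \<mu>1 M2 \<mu>2 \<longleftrightarrow>
      (\<exists>c>0. (AE s in lborel. 0 < s \<longrightarrow> f02 s = c * f01 (c * s) \<and> f2 s = c * f1 s) \<and> P01 = P02)"
    unfolding iff by (intro ex_cong1) blast
qed

end
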